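(* Let $g\ge 1$, let $\delta_1,\dots,\delta_g$ be positive integers with $\delta_j\mid\delta_{j+1}$ for $1\le j<g$, let $\Delta=\mathrm{diag}(\delta_1,\dots,\delta_g)$, and let $\Omega$ be a symmetric complex $g\times g$ matrix with positive definite imaginary part. Let $\Lambda=\Delta\mathbb{Z}^g+\Omega\mathbb{Z}^g$ and let $M=\mathbb{C}^g/\Lambda$ be the corresponding abelian variety of polarization type $(\delta_1,\dots,\delta_g)$. Then the theta functions $\theta[\Delta^{-1}\varepsilon,0](z|\Omega)$, where $\varepsilon$ runs over (representatives of) $\mathbb{Z}^g/\Delta\mathbb{Z}^g$, constitute a basis of the complex vector space $\mathcal{L}_M$ of theta functions of $M$.
   Context: Here $\langle x,y\rangle=\sum_j x_jy_j$ (bilinear), and $e_j$ is the $j$-th standard basis vector of $\mathbb{C}^g$. $\mathcal{L}_M$ is the space of entire functions $\theta(z|\Lambda)$ on $\mathbb{C}^g$ satisfying $$\theta(z+\lambda|\Lambda)=\theta(z|\Lambda)\quad(\lambda\in\Delta\mathbb{Z}^g),$$ $$\theta(z+\Omega e_j|\Lambda)=\exp(-\pi i\,\Omega_{jj}-2\pi i z_j)\,\theta(z|\Lambda)\quad(1\le j\le g).$$ For $a,b\in\mathbb{C}^g$, the theta function with characteristic $[a,b]$ is the absolutely convergent series $$\theta[a,b](z|\Omega)=\sum_{n\in\mathbb{Z}^g}\exp\bigl(\pi i\langle n+a,\Omega(n+a)\rangle+2\pi i\langle n+a,z+b\rangle\bigr).$$ The function $\theta[\Delta^{-1}\varepsilon,0](z|\Omega)$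 depends only on the class of $\varepsilon$ in $\mathbb{Z}^g/\Delta\mathbb{Z}^g$. *)

theory Defs
  imports "HOL-Analysis.Analysis" "HOL-Library.Function_Algebras"
begin

text \<open>The inner product of the library on \<open>complex ^ 'n\<close> is real-valued; this one is complex bilinear,
  without conjugation.\<close>

definition cdot :: "complex ^ 'n \<Rightarrow> complex ^ 'n \<Rightarrow> complex" where
  "cdot x y = (\<Sum>j\<in>UNIV. x $ j * y $ j)"

definition diag_mat :: "('n \<Rightarrow> 'a::zero) \<Rightarrow> 'a ^ 'n ^ 'n" where
  "diag_mat d = (\<chi> i j. if i = j then d i else 0)"

definition cvec :: "int ^ 'n \<Rightarrow> complex ^ 'n" where
  "cvec k = (\<chi> j. of_int (k $ j))"

text \<open>The matrix \<open>\<Delta>\<close>, over the integers or over the complex numbers.\<close>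

definition Delta :: "('n \<Rightarrow> nat) \<Rightarrow> 'a::semiring_1 ^ 'n ^ 'n" where
  "Delta \<delta> = diag_mat (\<lambda>j. of_nat (\<delta> j))"

definition positive_definite :: "real ^ 'n ^ 'n \<Rightarrow> bool" where
  "positive_definite A \<longleftrightarrow> transpose A = A \<and> (\<forall>x. x \<noteq> 0 \<longrightarrow> x \<bullet> (A *v x) > 0)"

text \<open>Holomorphic on all of \<open>\<complex>\<^sup>g\<close>: the Frechet derivative exists everywhere and is complex linear
  (\<open>has_derivative\<close> alone only gives real linearity).\<close>

definition entire :: "(complex ^ 'n \<Rightarrow> complex) \<Rightarrow> bool" where
  "entire f \<longleftrightarrow>
     (\<forall>z. \<exists>f'. (f has_derivative f') (at z) \<and> Vector_Spaces.linear (*s) (*) f')"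

text \<open>Theta functions of \<open>\<complex>\<^sup>g / (\<Delta> \<int>\<^sup>g + \<Omega> \<int>\<^sup>g)\<close>.\<close>

definition theta_space ::
    "('n \<Rightarrow> nat) \<Rightarrow> complex ^ 'n ^ 'n \<Rightarrow> (complex ^ 'n \<Rightarrow> complex) set" where
  "theta_space \<delta> \<Omega> = {\<theta>. entire \<theta> \<and>
     (\<forall>z k. \<theta> (z + Delta \<delta> *v cvec k) = \<theta> z) \<and>
     (\<forall>z j. \<theta> (z + \<Omega> *v axis j 1) =
              exp (- pi * \<i> * \<Omega> $ j $ j - 2 * pi * \<i> * z $ j) * \<theta> z)}"

definition theta_char ::
    "complex ^ 'n \<Rightarrow> complex ^ 'n \<Rightarrow> complex ^ 'n ^ 'n \<Rightarrow> complex ^ 'n \<Rightarrow> complex" where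
  "theta_char a b \<Omega> z =
     (\<Sum>\<^sub>\<infinity>n\<in>UNIV. exp (pi * \<i> * cdot (cvec n + a) (\<Omega> *v (cvec n + a))
                  + 2 * pi * \<i> * cdot (cvec n + a) (z + b)))"

text \<open>Congruence modulo \<open>\<Delta> \<int>\<^sup>g\<close>, so that \<open>\<int>\<^sup>g / \<Delta> \<int>\<^sup>g\<close> is \<open>UNIV // Delta_cong \<delta>\<close>.\<close>

definition Delta_cong :: "('n \<Rightarrow> nat) \<Rightarrow> ((int ^ 'n) \<times> (int ^ 'n)) set" where
  "Delta_cong \<delta> = {(x, y). x - y \<in> range (\<lambda>k. Delta \<delta> *v k)}"

definition representatives :: "('n \<Rightarrow> nat) \<Rightarrow> (int ^ 'n) set \<Rightarrow> bool" where
  "representatives \<delta> R \<longleftrightarrow> (\<forall>X \<in> UNIV // Delta_cong \<delta>. \<exists>!\<epsilon>. \<epsilon> \<in> R \<inter> X)"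

definition fun_scale :: "complex \<Rightarrow> ('a \<Rightarrow> complex) \<Rightarrow> 'a \<Rightarrow> complex" where
  "fun_scale c f = (\<lambda>x. c * f x)"

global_interpretation cfun: vector_space fun_scale
  by unfold_locales (simp_all add: fun_scale_def fun_eq_iff algebra_simps)

definition basis_family :: "('i \<Rightarrow> 'a \<Rightarrow> complex) \<Rightarrow> 'i set \<Rightarrow> ('a \<Rightarrow> complex) set \<Rightarrow> bool" where
  "basis_family f I V \<longleftrightarrow>
     inj_on f I \<and> cfun.independent (f ` I) \<and> cfun.span (f ` I) = V"

end

(*
  Fourier analysis on the real torus spanned by the columns of Delta. Translation by the columns of
  Delta makes the restriction of a theta function to any real torus periodic. Its Fourier coefficient
  c_m satisfies c_m(w + v) = exp(2 pi i <m, Delta^-1 v>) c_m(w) for all complex v, and the second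
  functional equation then determines c_{m + Delta k} from c_m up to a non-zero factor. Hence a theta
  function all of whose coefficients c_m(0), m in R, vanish is zero. On the other hand c_m(0) of the
  theta series attached to epsilon is non-zero exactly when m and epsilon are congruent mod Delta, so
  the theta series are biorthogonal to the functionals c_m(0), m in R.
*)
theory Submission
  imports Defs "HOL-Complex_Analysis.Conformal_Mappings"
begin

section \<open>Fourier series on the unit cube\<close>


text \<open>No Fourier expansion of a theta function is ever summed. Only uniqueness is used: a
  continuous periodic function all of whose coefficients vanish is zero. This avoids decay estimates
  for the coefficients of an unknown theta function; spanning follows by subtracting a finite
  combination with the same coefficients at the indices in R. The coefficients are integrals over a
  real torus, so a translation along that torus is a change of variable, whereas Omega e_j is a
  genuinely complex translation. The law for complex v is therefore reached by analytic
  continuation, one coordinate at a time. This is the reason for proving that the coefficients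
  depend holomorphically on the base point and, to that end, that the partial derivatives of an
  entire function are continuous. For the theta series themselves, positivity of Im Omega gives
  Gaussian decay that survives a weight exp(B |n + a|) for every B. This one estimate yields both
  entirety and termwise integration.\<close>

lemma int_vec_induct:
  fixes k :: "int ^ 'n"
  assumes "P 0" "\<And>k j. P k \<Longrightarrow> P (k + axis j 1)" "\<And>k j. P k \<Longrightarrow> P (k - axis j 1)"
  shows "P k"
proof -
  have step: "P (l + c *s axis j 1)" if "P l" for l j c
  proof (induction c rule: int_induct[of _ 0])
    case base
    then show ?case using that by simp
  next
    case (step1 i)
    then show ?case
      using assms(2)[of "l + i *s axis j 1" j] by (simp add: algebra_simps vector_sadd_rdistrib)
  next
    case (step2 i)
    then show ?case
      using assms(3)[of "l + i *s axis j 1" j] by (simp add: algebra_simps vec.scale_left_diff_distrib)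
  qed
  have "P (\<Sum>j\<in>S. k $ j *s axis j 1)" if "finite S" for S
    using that
  proof induction
    case empty
    then show ?case using assms(1) by simp
  next
    case (insert j S)
    then show ?case using step[of "\<Sum>j\<in>S. k $ j *s axis j 1" "k $ j" j] by (simp add: add.commute)
  qed
  from this[of UNIV] show ?thesis by (simp add: basis_expansion)
qed

definition unit_periodic :: "(real ^ 'n \<Rightarrow> complex) \<Rightarrow> bool" where
  "unit_periodic H \<longleftrightarrow> (\<forall>x j. H (x + axis j 1) = H x)"

definition rvec :: "int ^ 'n \<Rightarrow> real ^ 'n" where
  "rvec k = (\<chi> j. of_int (k $ j))"

lemma rvec_simps [simp]:
  "rvec 0 = 0" "rvec (k + l) = rvec k + rvec l" "rvec (k - l) = rvec k - rvec l"
  "rvec (axis j 1) = axis j 1" "rvec (- k) = - rvec k" "rvec k $ j = of_int (k $ j)"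
  by (auto simp: rvec_def vec_eq_iff axis_def)

lemma unit_periodic_int:
  assumes "unit_periodic H"
  shows "H (x + rvec k) = H x"
proof (induction k rule: int_vec_induct)
  case (2 k j)
  then show ?case
    using assms[unfolded unit_periodic_def, rule_format, of "x + rvec k" j] by (simp add: algebra_simps)
next
  case (3 k j)
  then show ?case
    using assms[unfolded unit_periodic_def, rule_format, of "x + rvec k - axis j 1" j]
    by (simp add: algebra_simps)
qed simp

text \<open>The shifted cube is cut by the hyperplane on which the j-th coordinate equals 1. By
  periodicity the overhanging slab can be moved back by one period, where it fills exactly the gap
  left at the bottom of the unit cube.\<close>

lemma integral_unit_cube_shift:
  fixes H :: "real ^ 'n \<Rightarrow> complex"
  assumes cont: "continuous_on UNIV H" and per: "unit_periodic H" and t: "0 \<le> t" "t \<le> 1"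
  shows "integral (cbox 0 1) (\<lambda>x. H (x + t *\<^sub>R axis j 1)) = integral (cbox 0 1) H"
proof -
  define e :: "real ^ 'n" where "e = axis j 1"
  have e: "e \<in> Basis" "\<And>x. x \<bullet> e = x $ j" by (auto simp: e_def inner_axis)
  have ei: "e $ i = (if i = j then 1 else 0)" for i by (auto simp: e_def axis_def)
  have int: "H integrable_on cbox a b" for a b
    by (rule integrable_continuous) (rule continuous_on_subset[OF cont], simp)
  have "integral (cbox 0 1) (\<lambda>x. H (x + t *\<^sub>R e)) = integral (cbox (t *\<^sub>R e) (1 + t *\<^sub>R e)) H"
    using integral_shift_cbox[of "t *\<^sub>R e" "t *\<^sub>R e" "1 + t *\<^sub>R e" H] by simp
  also have "\<dots> = integral (cbox (t *\<^sub>R e) (1 + t *\<^sub>R e) \<inter> {x. x \<bullet> e \<le> 1}) H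
               + integral (cbox (t *\<^sub>R e) (1 + t *\<^sub>R e) \<inter> {x. x \<bullet> e \<ge> 1}) H"
    by (rule integral_split[OF int e(1)])
  also have "cbox (t *\<^sub>R e) (1 + t *\<^sub>R e) \<inter> {x. x \<bullet> e \<le> 1} = cbox (t *\<^sub>R e) 1"
    using t by (auto simp: mem_box_cart e ei split: if_splits) (smt (verit) | metis)+
  also have "cbox (t *\<^sub>R e) (1 + t *\<^sub>R e) \<inter> {x. x \<bullet> e \<ge> 1} = cbox e (1 + t *\<^sub>R e)"
    using t by (auto simp: mem_box_cart e ei split: if_splits) (smt (verit) | metis)+
  also have "integral (cbox e (1 + t *\<^sub>R e)) H = integral (cbox 0 (1 + t *\<^sub>R e - e)) H"
    using integral_shift_cbox[of e e "1 + t *\<^sub>R e" H] per by (simp add: unit_periodic_def e_def)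
  also have "cbox 0 (1 + t *\<^sub>R e - e) = cbox 0 1 \<inter> {x. x \<bullet> e \<le> t}"
    using t by (auto simp: mem_box_cart e ei split: if_splits) (smt (verit) | metis)+
  also have "cbox (t *\<^sub>R e) 1 = cbox 0 1 \<inter> {x. x \<bullet> e \<ge> t}"
    using t by (auto simp: mem_box_cart e ei split: if_splits) (smt (verit) | metis)+
  also have "integral (cbox 0 1 \<inter> {x. x \<bullet> e \<ge> t}) H + integral (cbox 0 1 \<inter> {x. x \<bullet> e \<le> t}) H
      = integral (cbox 0 1) H"
    using integral_split[OF int e(1), of 0 1 t] by simp
  finally show ?thesis by (simp add: e_def)
qed

section \<open>Characters of the real torus and their orthogonality\<close>

definition torus_char :: "int ^ 'n \<Rightarrow> real ^ 'n \<Rightarrow> complex" where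
  "torus_char m x = cis (2 * pi * (rvec m \<bullet> x))"

lemma torus_char_0 [simp]: "torus_char 0 x = 1" "torus_char m 0 = 1"
  by (auto simp: torus_char_def)

lemma torus_char_mult: "torus_char m x * torus_char k x = torus_char (m + k) x"
  by (simp add: torus_char_def cis_mult inner_add_left algebra_simps)

lemma torus_char_add: "torus_char m (x + y) = torus_char m x * torus_char m y"
  by (simp add: torus_char_def cis_mult inner_add_right algebra_simps)

lemma torus_char_axis: "torus_char m (t *\<^sub>R axis j 1) = cis (2 * pi * (of_int (m $ j) * t))"
  by (simp add: torus_char_def inner_axis mult_ac)

lemma torus_char_continuous [continuous_intros]: "continuous_on S (torus_char m)"
  unfolding torus_char_def by (intro continuous_intros)

lemma unit_periodic_torus_char: "unit_periodic (torus_char m)"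
proof -
  have "torus_char m (axis j 1) = 1" for j
    using torus_char_axis[of m 1 j] cis_multiple_2pi[of "m $ j"] by (simp add: mult_ac)
  then show ?thesis by (simp add: unit_periodic_def torus_char_add)
qed

lemma unit_periodic_mult:
  "unit_periodic f \<Longrightarrow> unit_periodic g \<Longrightarrow> unit_periodic (\<lambda>x. f x * g x)"
  by (simp add: unit_periodic_def)

lemma content_unit_cube: "measure lborel (cbox 0 (1 :: real ^ 'n)) = 1"
proof -
  have "(1 :: real ^ 'n) \<in> cbox 0 1"
    by (simp add: mem_box_cart)
  then have "cbox 0 (1 :: real ^ 'n) \<noteq> {}"
    by blast
  then show ?thesis
    by (simp add: content_cbox_cart)
qed

lemma integral_torus_char:
  "integral (cbox 0 1) (torus_char m) = (if m = 0 then 1 else 0)"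
proof (cases "m = 0")
  case True
  then show ?thesis using integral_cong[of "cbox 0 1" "torus_char 0" "\<lambda>x. 1"]
    by (simp add: content_unit_cube)
next
  case False
  then obtain j where j: "m $ j \<noteq> 0" by (auto simp: vec_eq_iff)
  \<comment> \<open>Half a period of the character along axis j: this shift multiplies the character
    by -1 but preserves its integral, so the integral equals its own negative.\<close>
  define t :: real where "t = 1 / (2 * \<bar>m $ j\<bar>)"
  have t: "0 \<le> t" "t \<le> 1" using j by (auto simp: t_def field_simps)
  have "2 * pi * (m $ j * t) = pi \<or> 2 * pi * (m $ j * t) = - pi"
    using j by (auto simp: t_def abs_if)
  then have *: "torus_char m (t *\<^sub>R axis j 1) = - 1"
    using torus_char_axis[of m t j] by (elim disjE) (simp_all only:, simp_all add: complex_eq_iff)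
  have "integral (cbox 0 1) (\<lambda>x. torus_char m x * torus_char m (t *\<^sub>R axis j 1))
      = integral (cbox 0 1) (torus_char m)"
    using integral_unit_cube_shift[OF torus_char_continuous unit_periodic_torus_char t]
    by (simp add: torus_char_add)
  then show ?thesis using False by (simp add: *)
qed

lemma torus_char_uminus: "torus_char (- m) x = cnj (torus_char m x)"
  by (simp add: torus_char_def cis_cnj)

section \<open>Functions orthogonal to all characters\<close>

definition char_orthogonal :: "(real ^ 'n \<Rightarrow> complex) \<Rightarrow> bool" where
  "char_orthogonal K \<longleftrightarrow> continuous_on UNIV K \<and>
     (\<forall>m. integral (cbox 0 1) (\<lambda>x. K x * torus_char m x) = 0)"

lemma integrable_unit_cube:
  fixes f :: "real ^ 'n \<Rightarrow> complex"
  shows "continuous_on UNIV f \<Longrightarrow> f integrable_on cbox a b"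
  by (rule integrable_continuous) (rule continuous_on_subset, auto)

lemma char_orthogonal_add:
  assumes "char_orthogonal K" "char_orthogonal L"
  shows "char_orthogonal (\<lambda>x. K x + L x)"
  using assms unfolding char_orthogonal_def
  by (auto simp: distrib_right intro!: continuous_intros
      simp: integral_add integrable_unit_cube continuous_intros)

lemma char_orthogonal_scale:
  assumes "char_orthogonal K"
  shows "char_orthogonal (\<lambda>x. c * K x)"
  using assms unfolding char_orthogonal_def
  by (auto simp: mult.assoc intro!: continuous_intros)

lemma char_orthogonal_char:
  assumes "char_orthogonal K"
  shows "char_orthogonal (\<lambda>x. K x * torus_char k x)"
  using assms unfolding char_orthogonal_def
  by (auto simp: mult.assoc torus_char_mult intro!: continuous_intros)

lemma char_orthogonal_sum:
  assumes "finite S" "\<And>j. j \<in> S \<Longrightarrow> char_orthogonal (K j)"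
  shows "char_orthogonal (\<lambda>x. \<Sum>j\<in>S. K j x)"
  using assms
proof (induction S)
  case empty
  then show ?case by (simp add: char_orthogonal_def)
next
  case (insert j S)
  then show ?case by (simp add: char_orthogonal_add)
qed

text \<open>Embeds the torus as a product of unit circles. Real polynomials in the coordinates of
  complex space pull back to trigonometric polynomials, and the compact image is where
  Stone--Weierstrass is applied.\<close>

definition torus_point :: "real ^ 'n \<Rightarrow> complex ^ 'n" where
  "torus_point x = (\<chi> j. torus_char (axis j 1) x)"

lemma torus_point_continuous: "continuous_on S torus_point"
  unfolding torus_point_def by (intro continuous_intros)

lemma bounded_linear_complex_vec_expansion:
  fixes f :: "complex ^ 'n \<Rightarrow> real"
  assumes "bounded_linear f"
  shows "f u = (\<Sum>j\<in>UNIV. Re (u $ j) * f (axis j 1) + Im (u $ j) * f (axis j \<i>))"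
proof -
  interpret bounded_linear f by fact
  have "u = (\<Sum>j\<in>UNIV. Re (u $ j) *\<^sub>R axis j 1 + Im (u $ j) *\<^sub>R axis j \<i>)"
  proof (subst vec_eq_iff, intro allI)
    fix i
    have "(\<Sum>j\<in>UNIV. Re (u $ j) *\<^sub>R axis j 1 + Im (u $ j) *\<^sub>R axis j \<i>) $ i
        = (\<Sum>j\<in>UNIV. if j = i then u $ j else 0)"
      unfolding sum_component
      by (rule sum.cong) (auto simp: axis_def complex_eq_iff)
    then show "u $ i = (\<Sum>j\<in>UNIV. Re (u $ j) *\<^sub>R axis j 1 + Im (u $ j) *\<^sub>R axis j \<i>) $ i"
      by simp
  qed
  then have "f u = f (\<Sum>j\<in>UNIV. Re (u $ j) *\<^sub>R axis j 1 + Im (u $ j) *\<^sub>R axis j \<i>)"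
    by simp
  then show ?thesis
    by (simp add: sum add scaleR)
qed

text \<open>A real linear form restricted to the torus is a combination of the characters of index
  e_j and -e_j, and multiplying by a character only permutes the orthogonality conditions.
  \<open>K\<close> is generalized in the induction so that a product can be treated one factor at a
  time.\<close>

lemma char_orthogonal_polynomial:
  assumes "real_polynomial_function p" "char_orthogonal K"
  shows "char_orthogonal (\<lambda>x. K x * of_real (p (torus_point x)))"
  using assms
proof (induction arbitrary: K rule: real_polynomial_function.induct)
  case (linear f)
  \<comment> \<open>With real p and q, p Re u + q Im u = ((p - \<i> q) / 2) u + ((p + \<i> q) / 2)
    (cnj u).\<close>
  define a where "a j = (of_real (f (axis j 1)) - \<i> * of_real (f (axis j \<i>))) / 2" for j
  define b where "b j = (of_real (f (axis j 1)) + \<i> * of_real (f (axis j \<i>))) / 2" for j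
  have "K x * of_real (f (torus_point x))
      = (\<Sum>j\<in>UNIV. a j * (K x * torus_char (axis j 1) x) + b j * (K x * torus_char (- axis j 1) x))" for x
  proof -
    have "of_real (Re z * f (axis j 1) + Im z * f (axis j \<i>)) = a j * z + b j * cnj z" for z j
      by (simp add: a_def b_def complex_eq_iff field_simps)
    then have "of_real (f (torus_point x))
        = (\<Sum>j\<in>UNIV. a j * torus_char (axis j 1) x + b j * torus_char (- axis j 1) x)"
      unfolding bounded_linear_complex_vec_expansion[OF linear(1), of "torus_point x"] of_real_sum
      unfolding torus_char_uminus torus_point_def vec_lambda_beta
      by (intro sum.cong refl)
    then show ?thesis
      by (simp only: sum_distrib_left distrib_left mult.left_commute)
  qed
  moreover have "char_orthogonal (\<lambda>x. \<Sum>j\<in>UNIV. a j * (K x * torus_char (axis j 1) x)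
      + b j * (K x * torus_char (- axis j 1) x))"
    using linear(2)
    by (intro char_orthogonal_sum char_orthogonal_add char_orthogonal_scale char_orthogonal_char)
      simp_all
  ultimately show ?case by simp
next
  case (const c)
  then show ?case
    using char_orthogonal_scale[of K "of_real c"] by (simp only: mult.commute)
next
  case (add f g)
  then show ?case
    unfolding of_real_add distrib_left by (intro char_orthogonal_add) blast+
next
  case (mult f g)
  \<comment> \<open>The factor \<open>f\<close> is absorbed into \<open>K\<close> first; the
    hypothesis for \<open>g\<close> is then applied to the resulting orthogonal function.\<close>
  then show ?case
    unfolding of_real_mult mult.assoc[symmetric] by blast
qed

lemma torus_point_eq_imp:
  assumes "torus_point x = torus_point y"
  obtains k where "x = y + rvec k"
proof -
  have "\<exists>n::int. x $ j = y $ j + n" for j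
  proof -
    have "cis (2 * pi * x $ j) = cis (2 * pi * y $ j)"
      using assms by (simp add: torus_point_def vec_eq_iff torus_char_def inner_axis')
    then have "\<exists>n::int. 2 * pi * x $ j = 2 * pi * y $ j + 2 * pi * n"
      using sin_cos_eq_iff[of "2 * pi * x $ j" "2 * pi * y $ j"] by (simp add: complex_eq_iff)
    then obtain n :: int where "2 * pi * x $ j = 2 * pi * y $ j + 2 * pi * n" ..
    then have "2 * pi * x $ j = 2 * pi * (y $ j + n)" by (simp add: algebra_simps)
    then show ?thesis by auto
  qed
  then obtain k where "\<And>j. x $ j = y $ j + of_int (k j)" by metis
  then show ?thesis by (intro that[of "\<chi> j. k j"]) (simp add: vec_eq_iff)
qed

text \<open>Points of the cube with the same image differ by a lattice vector, so \<open>H\<close>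
  descends to the torus. Continuity comes from compactness: the preimage under \<open>G\<close> of a
  closed set is the image of a compact subset of the cube.\<close>

lemma unit_periodic_factors:
  assumes cont: "continuous_on UNIV H" and per: "unit_periodic H"
  obtains G where "continuous_on (torus_point ` cbox 0 1) G" "\<And>x. x \<in> cbox 0 1 \<Longrightarrow> G (torus_point x) = H x"
proof -
  define S where "S = torus_point ` cbox 0 (1 :: real ^ 'a)"
  define G where "G u = H (inv_into (cbox 0 1) torus_point u)" for u
  have G: "G (torus_point x) = H x" if "x \<in> cbox 0 1" for x
  proof -
    have "torus_point (inv_into (cbox 0 1) torus_point (torus_point x)) = torus_point x"
      using that by (intro f_inv_into_f) auto
    then obtain k where "inv_into (cbox 0 1) torus_point (torus_point x) = x + rvec k"
      using torus_point_eq_imp by blast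
    then show ?thesis by (simp add: G_def unit_periodic_int[OF per])
  qed
  have "closed S"
    unfolding S_def
    by (intro compact_imp_closed compact_continuous_image torus_point_continuous compact_cbox)
  moreover have "closed (G -` B \<inter> S)" if "closed B" for B
  proof -
    have "G -` B \<inter> S = torus_point ` (H -` B \<inter> cbox 0 1)"
      by (auto simp: S_def G)
    moreover have "compact (H -` B \<inter> cbox 0 1)"
      using closed_vimage[OF that cont] by (intro closed_Int_compact) auto
    ultimately show ?thesis
      by (simp add: compact_imp_closed compact_continuous_image torus_point_continuous)
  qed
  ultimately have "continuous_on S G"
    by (simp add: continuous_on_closed_vimage)
  then show ?thesis using that G by (simp add: S_def)
qed

text \<open>By Stone--Weierstrass on the torus, \<open>H\<close> is uniformly close to a polynomial in the characters,
  to which it is orthogonal; hence its square norm vanishes.\<close>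

lemma fourier_uniqueness:
  fixes H :: "real ^ 'n \<Rightarrow> complex"
  assumes per: "unit_periodic H" and orth: "char_orthogonal H"
  shows "H x = 0"
proof -
  have cont: "continuous_on UNIV H" using orth by (simp add: char_orthogonal_def)
  define I where "I = integral (cbox 0 1) (\<lambda>x. H x * cnj (H x))"
  obtain G where G: "continuous_on (torus_point ` cbox 0 1) G"
    "\<And>x. x \<in> cbox 0 1 \<Longrightarrow> G (torus_point x) = H x"
    using unit_periodic_factors[OF cont per] by blast
  have "compact (H ` cbox 0 1)"
    by (intro compact_continuous_image compact_cbox continuous_on_subset[OF cont]) simp
  then obtain M where M: "M > 0" "\<And>x. x \<in> cbox 0 1 \<Longrightarrow> norm (H x) \<le> M"
    using compact_imp_bounded[THEN bounded_pos[THEN iffD1]] by (metis imageI)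
  \<comment> \<open>\<open>I\<close> is the square norm of \<open>H\<close>. Subtracting the
    vanishing integral of \<open>H\<close> times a conjugated polynomial replaces
    \<open>cnj (H x)\<close> by an error below e, while \<open>M\<close> bounds the other
    factor.\<close>
  have bound: "norm I \<le> M * e" if "e > 0" for e
  proof -
    obtain g where g: "polynomial_function g" "\<And>u. u \<in> torus_point ` cbox 0 1 \<Longrightarrow> norm (G u - g u) < e"
      using Stone_Weierstrass_polynomial_function[OF _ G(1) \<open>e > 0\<close>] torus_point_continuous
      by (metis compact_cbox compact_continuous_image)
    have pr: "real_polynomial_function (\<lambda>u. Re (g u))" "real_polynomial_function (\<lambda>u. Im (g u))"
      using g(1) bounded_linear_Re bounded_linear_Im by (auto simp: polynomial_function_def o_def)
    \<comment> \<open>The conjugate appears because \<open>I\<close> pairs \<open>H\<close> with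
      \<open>cnj H\<close>. Its real and imaginary parts are treated separately as real
      polynomials.\<close>
    define h where "h x = cnj (g (torus_point x))" for x :: "real ^ 'n"
    have "H x * h x = H x * of_real (Re (g (torus_point x))) + (- \<i>) * (H x * of_real (Im (g (torus_point x))))" for x
      by (simp add: h_def complex_eq_iff)
    moreover have "char_orthogonal (\<lambda>x. H x * of_real (Re (g (torus_point x)))
        + (- \<i>) * (H x * of_real (Im (g (torus_point x)))))"
      by (intro char_orthogonal_add char_orthogonal_scale char_orthogonal_polynomial orth pr)
    ultimately have oh: "char_orthogonal (\<lambda>x. H x * h x)" by simp
    have h0: "integral (cbox 0 1) (\<lambda>x. H x * h x) = 0"
      using oh unfolding char_orthogonal_def by (auto dest: spec[of _ 0])
    have ih: "(\<lambda>x. H x * h x) integrable_on cbox 0 1"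
      using oh unfolding char_orthogonal_def by (intro integrable_unit_cube) auto
    have iH: "(\<lambda>x. H x * cnj (H x)) integrable_on cbox 0 1"
      by (intro integrable_unit_cube continuous_intros cont)
    have "((\<lambda>x. H x * cnj (H x) - H x * h x) has_integral I - 0) (cbox 0 1)"
      unfolding I_def h0[symmetric] by (intro has_integral_diff integrable_integral ih iH)
    then have "norm (I - 0) \<le> (M * e) * measure lborel (cbox 0 (1 :: real ^ 'n))"
    proof (rule has_integral_bound[rotated])
      fix x :: "real ^ 'n" assume x: "x \<in> cbox 0 1"
      have "norm (cnj (H x) - h x) \<le> e"
        using g(2)[of "torus_point x"] x G(2)[OF x]
        by (metis complex_cnj_diff complex_mod_cnj h_def imageI less_imp_le)
      then show "norm (H x * cnj (H x) - H x * h x) \<le> M * e"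
        unfolding right_diff_distrib[symmetric] norm_mult using M x by (intro mult_mono) auto
    qed (use M \<open>e > 0\<close> in auto)
    then show ?thesis by (simp add: content_unit_cube)
  qed
  have "I = 0"
  proof (rule ccontr)
    assume "I \<noteq> 0"
    \<comment> \<open>For this e the bound says that |I| is at most |I| / 2.\<close>
    then show False using bound[of "norm I / (2 * M)"] M(1) by (simp add: field_simps)
  qed
  have cr: "continuous_on (cbox 0 1) (\<lambda>x. (norm (H x))\<^sup>2)"
    by (intro continuous_intros continuous_on_subset[OF cont]) simp
  have "((\<lambda>x. of_real ((norm (H x))\<^sup>2) :: complex) has_integral I) (cbox 0 1)"
    unfolding I_def complex_norm_square
    by (intro integrable_integral integrable_unit_cube continuous_intros cont)
  from has_integral_linear[OF this bounded_linear_Re]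
  have "((\<lambda>x. (norm (H x))\<^sup>2) has_integral 0) (cbox 0 1)"
    unfolding o_def Re_complex_of_real \<open>I = 0\<close> by simp
  \<comment> \<open>The midpoint shows that the open cube is nonempty; a continuous non-negative
    function with integral zero then vanishes on the closed cube.\<close>
  moreover have "(\<chi> j. 1 / 2) \<in> box 0 (1 :: real ^ 'n)"
    by (simp add: mem_box_cart)
  ultimately have zero: "H y = 0" if "y \<in> cbox 0 1" for y
    using has_integral_0_cbox_imp_0[OF cr _ _ _ that] by auto
  define k where "k = (\<chi> j. \<lfloor>x $ j\<rfloor>)"
  have "x - rvec k \<in> cbox 0 1"
    unfolding mem_box_cart by (simp add: k_def) linarith
  from zero[OF this] show ?thesis
    using unit_periodic_int[OF per, of "x - rvec k" k] by simp
qed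

section \<open>Fourier coefficients of theta functions\<close>


lemma Delta_mult_nth [simp]: "(Delta \<delta> *v v) $ j = of_nat (\<delta> j) * v $ j"
  by (simp add: Delta_def diag_mat_def matrix_vector_mult_def if_distrib[of "\<lambda>x. x * _"] cong: if_cong)

lemma cvec_nth [simp]: "cvec k $ j = of_int (k $ j)"
  by (simp add: cvec_def)

section \<open>One-variable slices and partial derivatives of entire functions\<close>

lemma norm_scaled_axis: "norm (s *s (axis j 1 :: complex ^ 'n)) = norm s"
proof -
  have "s *s (axis j 1 :: complex ^ 'n) = axis j s"
    by (auto simp: vec_eq_iff axis_def)
  moreover have "(norm (axis j s $ i))\<^sup>2 = (if i = j then (norm s)\<^sup>2 else 0)" for i
    by (simp add: axis_def)
  ultimately show ?thesis
    by (simp add: norm_vec_def L2_set_def)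
qed

lemma entire_continuous: "entire f \<Longrightarrow> continuous_on S f"
  unfolding entire_def by (metis continuous_at_imp_continuous_on has_derivative_continuous)

definition partial_deriv :: "'n \<Rightarrow> (complex ^ 'n \<Rightarrow> complex) \<Rightarrow> complex ^ 'n \<Rightarrow> complex" where
  "partial_deriv j f z = deriv (\<lambda>s. f (z + s *s axis j 1)) 0"

lemma bounded_linear_scaled_axis: "bounded_linear (\<lambda>s. s *s (axis j 1 :: complex ^ 'n))"
  by (rule bounded_linear_intro[of _ 1]) (auto simp: vec_eq_iff algebra_simps norm_scaled_axis)

text \<open>Complex linearity of the Frechet derivative gives f'(h e_j) = f'(e_j) h, so each slice
  is complex differentiable. Recentring the slice at s identifies its derivative there with the
  partial derivative at the shifted point.\<close>

lemma entire_has_partial_deriv: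
  assumes "entire f"
  shows "((\<lambda>s. f (w + s *s axis j 1)) has_field_derivative partial_deriv j f (w + s *s axis j 1)) (at s)"
proof -
  have ex: "\<exists>D. ((\<lambda>s. f (v + s *s axis j 1)) has_field_derivative D) (at t)" for v t
  proof -
    obtain f' where f': "(f has_derivative f') (at (v + t *s axis j 1))" "Vector_Spaces.linear (*s) (*) f'"
      using assms unfolding entire_def by blast
    have "((\<lambda>s. v + s *s axis j 1) has_derivative (\<lambda>s. s *s axis j 1)) (at t)"
      by (auto intro!: derivative_eq_intros bounded_linear_imp_has_derivative bounded_linear_scaled_axis)
    from has_derivative_compose[OF this f'(1)]
    have "((\<lambda>s. f (v + s *s axis j 1)) has_derivative (\<lambda>h. f' (h *s axis j 1))) (at t)" .
    moreover have "f' (h *s axis j 1) = f' (axis j 1) * h" for h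
      using module_hom.scale[of "(*s)" "(*)" f'] f'(2) by (simp add: Vector_Spaces.linear_def mult.commute)
    ultimately show ?thesis by (auto simp: has_field_derivative_def)
  qed
  obtain D where D: "((\<lambda>t. f (w + t *s axis j 1)) has_field_derivative D) (at (s + 0))"
    using ex by auto
  have "((\<lambda>t. f (w + (s + t) *s axis j 1)) has_field_derivative D) (at 0)"
    using DERIV_shift[of "\<lambda>t. f (w + t *s axis j 1)" D 0 s] D by (simp add: add.commute)
  then have "partial_deriv j f (w + s *s axis j 1) = D"
    unfolding partial_deriv_def by (intro DERIV_imp_deriv) (simp add: vector_sadd_rdistrib add.assoc)
  then show ?thesis using D by simp
qed

lemma entire_slice_holomorphic:
  "entire f \<Longrightarrow> (\<lambda>s. f (w + s *s axis j 1)) holomorphic_on S"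
  unfolding holomorphic_on_def field_differentiable_def
  using entire_has_partial_deriv has_field_derivative_at_within by blast

text \<open>Entirety asserts only that derivatives exist at each point. Cauchy's inequality on a
  unit circle bounds the difference of two partial derivatives by the difference of the function
  values on that circle, which is small by uniform continuity.\<close>

lemma partial_deriv_continuous:
  assumes f: "entire f"
  shows "continuous_on S (partial_deriv j f)"
proof -
  have "\<exists>d>0. \<forall>z. dist z z0 < d \<longrightarrow> dist (partial_deriv j f z) (partial_deriv j f z0) < e"
    if "e > 0" for z0 e
  proof -
    \<comment> \<open>Radius 2 leaves room for a point within distance 1 of \<open>z0\<close>
      together with the unit circle around it in direction j.\<close>
    have "uniformly_continuous_on (cball z0 2) f"
      by (intro compact_uniformly_continuous entire_continuous f compact_cball)
    then obtain d where d: "d > 0"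
      "\<And>z z'. z \<in> cball z0 2 \<Longrightarrow> z' \<in> cball z0 2 \<Longrightarrow> dist z' z < d \<Longrightarrow> dist (f z') (f z) < e / 2"
      using \<open>e > 0\<close> unfolding uniformly_continuous_on_def by (metis half_gt_zero)
    have "dist (partial_deriv j f z) (partial_deriv j f z0) < e" if z: "dist z z0 < min d 1" for z
    proof -
      define g where "g s = f (z + s *s axis j 1) - f (z0 + s *s axis j 1)" for s
      have der: "(g has_field_derivative partial_deriv j f z - partial_deriv j f z0) (at 0)"
        unfolding g_def
        using DERIV_diff[OF entire_has_partial_deriv[OF f, of z j 0] entire_has_partial_deriv[OF f, of z0 j 0]]
        by simp
      have hol: "g holomorphic_on UNIV"
        unfolding g_def by (intro holomorphic_intros entire_slice_holomorphic f)
      have "norm ((deriv ^^ 1) g 0) \<le> fact 1 * (e / 2) / 1 ^ 1"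
      proof (rule Cauchy_inequality)
        show "norm (g s) \<le> e / 2" if "norm (0 - s) = 1" for s
        proof -
          have "dist z0 (z + s *s axis j 1) \<le> dist z0 z + norm (s *s (axis j 1 :: complex ^ 'a))"
            by (metis dist_triangle dist_add_cancel2 dist_norm add_diff_cancel_left' norm_minus_commute)
          then have "z + s *s axis j 1 \<in> cball z0 2"
            using z that by (simp add: norm_scaled_axis dist_commute)
          moreover have "z0 + s *s axis j 1 \<in> cball z0 2"
            using that by (simp add: norm_scaled_axis dist_norm)
          ultimately show ?thesis
            using d(2)[of "z0 + s *s axis j 1" "z + s *s axis j 1"] z
            by (simp add: g_def dist_norm less_imp_le)
        qed
      qed (auto intro: holomorphic_on_subset[OF hol] holomorphic_on_imp_continuous_on)
      then show ?thesis
        using \<open>e > 0\<close> DERIV_imp_deriv[OF der] by (simp add: dist_norm)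
    qed
    then show ?thesis using d(1) by (intro exI[of _ "min d 1"]) auto
  qed
  then have "continuous_on UNIV (partial_deriv j f)"
    unfolding continuous_on_iff by auto
  then show ?thesis by (rule continuous_on_subset) simp
qed

text \<open>Parametrises the real span of the columns of \<Delta> so that their lattice becomes the
  integer lattice and the unit cube a fundamental domain.\<close>

definition dilate :: "('n \<Rightarrow> nat) \<Rightarrow> real ^ 'n \<Rightarrow> complex ^ 'n" where
  "dilate \<delta> x = (\<chi> j. of_real (of_nat (\<delta> j) * x $ j))"

lemma dilate_simps [simp]:
  "dilate \<delta> (x + y) = dilate \<delta> x + dilate \<delta> y"
  "dilate \<delta> 0 = 0"
  "dilate \<delta> x $ j = of_nat (\<delta> j) * of_real (x $ j)"
  by (auto simp: dilate_def vec_eq_iff algebra_simps)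

lemma dilate_axis: "dilate \<delta> (t *\<^sub>R axis j 1) = of_real (of_nat (\<delta> j) * t) *s axis j 1"
  by (auto simp: vec_eq_iff axis_def)

lemma dilate_continuous [continuous_intros]:
  "continuous_on S f \<Longrightarrow> continuous_on S (\<lambda>x. dilate \<delta> (f x))"
  unfolding dilate_def by (intro continuous_intros)

text \<open>The base point \<open>w\<close> is complex and kept as an argument because translation
  by a column of \<Omega> leaves the real torus through the origin.\<close>

definition fourier_coeff ::
    "('n \<Rightarrow> nat) \<Rightarrow> (complex ^ 'n \<Rightarrow> complex) \<Rightarrow> int ^ 'n \<Rightarrow> complex ^ 'n \<Rightarrow> complex" where
  "fourier_coeff \<delta> f m w = integral (cbox 0 1) (\<lambda>x. f (w + dilate \<delta> x) * torus_char (- m) x)"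

lemma fourier_integrand_continuous:
  assumes "continuous_on UNIV f"
  shows "continuous_on S (\<lambda>x. f (w + dilate \<delta> x) * torus_char m x)"
  by (intro continuous_intros continuous_on_compose2[OF assms]) auto

text \<open>Differentiation under the integral sign; joint continuity of the differentiated
  integrand comes from \<open>partial_deriv_continuous\<close>.\<close>

lemma fourier_coeff_holomorphic:
  assumes f: "entire f"
  shows "(\<lambda>s. fourier_coeff \<delta> f m (w + s *s axis j 1)) holomorphic_on UNIV"
  unfolding fourier_coeff_def
proof (rule leibniz_rule_holomorphic[where fx =
      "\<lambda>s x. partial_deriv j f (w + s *s axis j 1 + dilate \<delta> x) * torus_char (- m) x"])
  show "((\<lambda>s. f (w + s *s axis j 1 + dilate \<delta> x) * torus_char (- m) x) has_field_derivative
      partial_deriv j f (w + s *s axis j 1 + dilate \<delta> x) * torus_char (- m) x) (at s within UNIV)" for s x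
    using DERIV_cmult_right[OF entire_has_partial_deriv[OF f, of "w + dilate \<delta> x" j s]]
    by (simp add: add_ac)
  show "(\<lambda>x. f (w + s *s axis j 1 + dilate \<delta> x) * torus_char (- m) x) integrable_on cbox 0 1" for s
    by (intro integrable_continuous fourier_integrand_continuous entire_continuous f)
  have "continuous_on (UNIV \<times> cbox 0 1) (\<lambda>p. partial_deriv j f
      (w + fst p *s axis j 1 + dilate \<delta> (snd p)) * torus_char (- m) (snd p))"
    by (intro continuous_intros continuous_on_compose2[OF partial_deriv_continuous[OF f, of UNIV]]
        continuous_on_compose2[OF torus_char_continuous[of UNIV]]
        bounded_linear.continuous_on[OF bounded_linear_scaled_axis]) auto
  then show "continuous_on (UNIV \<times> cbox 0 1) (\<lambda>(s, x). partial_deriv j f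
      (w + s *s axis j 1 + dilate \<delta> x) * torus_char (- m) x)"
    by (simp add: case_prod_unfold)
qed auto

text \<open>Both sides are entire in \<open>s\<close>, and for real \<open>s\<close> they agree because the integral of a periodic
  function over the unit cube is translation invariant.\<close>

lemma fourier_coeff_shift_axis:
  assumes f: "entire f" and per: "unit_periodic (\<lambda>x. f (w + dilate \<delta> x))" and pos: "\<delta> j > 0"
  shows "fourier_coeff \<delta> f m (w + s *s axis j 1)
       = exp (2 * pi * \<i> * (of_int (m $ j) * s / of_nat (\<delta> j))) * fourier_coeff \<delta> f m w"
proof -
  define F where "F s = fourier_coeff \<delta> f m (w + s *s axis j 1)" for s
  define E where "E s = exp (2 * pi * \<i> * (of_int (m $ j) * s / of_nat (\<delta> j)))" for s
  have F0: "F 0 = fourier_coeff \<delta> f m w" by (simp add: F_def)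
  have real: "F (of_real u) = E (of_real u) * F 0" if u: "u \<in> {0..1}" for u
  proof -
    \<comment> \<open>A shift by u in the j-th complex coordinate is a shift by u / \<delta>_j in
      cube coordinates; it stays in [0,1] because \<delta>_j is at least 1.\<close>
    define t where "t = u / of_nat (\<delta> j)"
    have "real (\<delta> j) \<ge> 1" using pos by simp
    then have t: "0 \<le> t" "t \<le> 1" "of_nat (\<delta> j) * t = u"
      using u pos by (auto simp: t_def field_simps)
    define H where "H x = f (w + dilate \<delta> x) * torus_char (- m) x" for x
    have tc: "of_nat (\<delta> j) * complex_of_real t = of_real u"
      by (metis of_real_mult of_real_of_nat_eq t(3))
    \<comment> \<open>Moving the argument of \<open>H\<close> by t e_j also multiplies its
      character, of index -m, by a constant. The prefactor cancels that constant.\<close>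
    have "f (w + of_real u *s axis j 1 + dilate \<delta> x) * torus_char (- m) x
        = torus_char m (t *\<^sub>R axis j 1) * H (x + t *\<^sub>R axis j 1)" for x
    proof -
      have "torus_char m (t *\<^sub>R axis j 1) * H (x + t *\<^sub>R axis j 1)
          = (torus_char m (t *\<^sub>R axis j 1) * torus_char (- m) (t *\<^sub>R axis j 1)) *
            (f (w + of_real u *s axis j 1 + dilate \<delta> x) * torus_char (- m) x)"
        by (simp add: H_def torus_char_add dilate_axis tc add.assoc add.commute[of "dilate \<delta> x"])
      then show ?thesis by (simp add: torus_char_mult)
    qed
    then have "F (of_real u)
        = integral (cbox 0 1) (\<lambda>x. torus_char m (t *\<^sub>R axis j 1) * H (x + t *\<^sub>R axis j 1))"
      by (simp add: F_def fourier_coeff_def)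
    also have "\<dots> = torus_char m (t *\<^sub>R axis j 1) * integral (cbox 0 1) (\<lambda>x. H (x + t *\<^sub>R axis j 1))"
      by simp
    also have "integral (cbox 0 1) (\<lambda>x. H (x + t *\<^sub>R axis j 1)) = integral (cbox 0 1) H"
      unfolding H_def
      by (intro integral_unit_cube_shift t fourier_integrand_continuous entire_continuous f
          unit_periodic_mult per unit_periodic_torus_char)
    also have "integral (cbox 0 1) H = F 0"
      by (simp add: F_def fourier_coeff_def H_def[abs_def])
    also have "torus_char m (t *\<^sub>R axis j 1) = E (of_real u)"
      using pos by (simp add: torus_char_axis E_def t_def cis_conv_exp mult_ac)
    finally show ?thesis .
  qed
  have "F s - E s * F 0 = 0"
  proof (rule analytic_continuation[where f = "\<lambda>s. F s - E s * F 0" and w = s and S = UNIV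
        and U = "of_real ` {0..1}" and \<xi> = 0])
    show "(\<lambda>s. F s - E s * F 0) holomorphic_on UNIV"
      unfolding F_def E_def using pos by (intro holomorphic_intros fourier_coeff_holomorphic f) auto
    \<comment> \<open>A connected set with more than one point has no isolated points, so 0 is a
      limit point of the segment on which both sides agree.\<close>
    have "connected (complex_of_real ` {0..1})"
      by (intro connected_continuous_image continuous_intros) auto
    moreover have "(1 :: complex) \<in> of_real ` {0..1}" by (rule image_eqI[of _ _ 1]) auto
    moreover have "(0 :: complex) \<in> of_real ` {0..1}" by (rule image_eqI[of _ _ 0]) auto
    moreover have "\<not> (\<exists>a. of_real ` {0..1} = {a :: complex})"
      using calculation(2,3) by (metis singletonD zero_neq_one)
    ultimately show "(0 :: complex) islimpt of_real ` {0..1}"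
      by (intro connected_imp_perfect) blast+
  qed (auto simp: real)
  then show ?thesis by (simp add: F_def E_def)
qed

text \<open>A complex translation is composed of translations along the axes, whose exponents add
  up. Periodicity is assumed at every base point because the intermediate points of this composition
  occur as base points.\<close>

lemma fourier_coeff_shift:
  assumes f: "entire f" and per: "\<And>w. unit_periodic (\<lambda>x. f (w + dilate \<delta> x))" and pos: "\<And>j. \<delta> j > 0"
  shows "fourier_coeff \<delta> f m (w + v)
       = exp (2 * pi * \<i> * (\<Sum>j\<in>UNIV. of_int (m $ j) * v $ j / of_nat (\<delta> j))) * fourier_coeff \<delta> f m w"
proof -
  have "fourier_coeff \<delta> f m (w + (\<Sum>j\<in>S. v $ j *s axis j 1))
       = exp (2 * pi * \<i> * (\<Sum>j\<in>S. of_int (m $ j) * v $ j / of_nat (\<delta> j))) * fourier_coeff \<delta> f m w"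
    if "finite S" for S
    using that
  proof induction
    case (insert j S)
    have "w + (\<Sum>i\<in>insert j S. v $ i *s axis i 1) = (w + (\<Sum>i\<in>S. v $ i *s axis i 1)) + v $ j *s axis j 1"
      using insert by (simp add: add_ac)
    moreover have "exp (2 * pi * \<i> * (\<Sum>i\<in>insert j S. of_int (m $ i) * v $ i / of_nat (\<delta> i)))
        = exp (2 * pi * \<i> * (of_int (m $ j) * v $ j / of_nat (\<delta> j)))
          * exp (2 * pi * \<i> * (\<Sum>i\<in>S. of_int (m $ i) * v $ i / of_nat (\<delta> i)))"
      by (simp only: sum.insert[OF insert(1,2)] distrib_left exp_add)
    ultimately show ?case
      using insert(3) fourier_coeff_shift_axis[OF f, where \<delta> = \<delta> and j = j and m = m, OF per pos, where w = "w + (\<Sum>i\<in>S. v $ i *s axis i 1)" and s = "v $ j"]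
      by (simp only: mult.assoc)
  qed simp
  from this[of UNIV] show ?thesis by (simp add: basis_expansion)
qed

section \<open>What the functional equations impose on the coefficients\<close>

lemma theta_space_unit_periodic:
  assumes "\<theta> \<in> theta_space \<delta> \<Omega>"
  shows "unit_periodic (\<lambda>x. \<theta> (w + dilate \<delta> x))"
proof -
  have "dilate \<delta> (axis j 1) = Delta \<delta> *v cvec (axis j 1)" for j
    by (auto simp: vec_eq_iff axis_def)
  then show ?thesis
    using assms unfolding theta_space_def unit_periodic_def by (simp flip: add.assoc)
qed

text \<open>The coefficient at base point \<Omega> e_j is computed twice. By the shift law it is a
  non-zero multiple of the coefficient at 0. By the functional equation the integrand acquires
  exp(-2 pi \<i> z_j), which on the real torus is the character of index -\<delta>_j e_j and so
  raises the index m by \<delta>_j e_j.\<close>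

lemma fourier_coeff_recursion:
  assumes th: "\<theta> \<in> theta_space \<delta> \<Omega>" and pos: "\<And>j. \<delta> j > 0"
  shows "fourier_coeff \<delta> \<theta> (m + int (\<delta> j) *s axis j 1) 0 = 0 \<longleftrightarrow> fourier_coeff \<delta> \<theta> m 0 = 0"
proof -
  have ent: "entire \<theta>" using th by (simp add: theta_space_def)
  have "\<theta> (\<Omega> *v axis j 1 + dilate \<delta> x) * torus_char (- m) x
      = exp (- pi * \<i> * \<Omega> $ j $ j) * (\<theta> (dilate \<delta> x) * torus_char (- (m + int (\<delta> j) *s axis j 1)) x)" for x
  proof -
    have "rvec (int (\<delta> j) *s axis j 1) = real (\<delta> j) *\<^sub>R axis j 1"
      by (auto simp: vec_eq_iff axis_def)
    then have "torus_char (- (int (\<delta> j) *s axis j 1)) x = exp (- 2 * pi * \<i> * dilate \<delta> x $ j)"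
      by (simp add: torus_char_def inner_axis' cis_conv_exp mult_ac)
    moreover have "torus_char (- (m + int (\<delta> j) *s axis j 1)) x
        = torus_char (- m) x * torus_char (- (int (\<delta> j) *s axis j 1)) x"
      by (simp add: torus_char_mult)
    moreover have "\<theta> (\<Omega> *v axis j 1 + dilate \<delta> x)
        = exp (- pi * \<i> * \<Omega> $ j $ j) * exp (- 2 * pi * \<i> * dilate \<delta> x $ j) * \<theta> (dilate \<delta> x)"
      using th by (simp add: theta_space_def add.commute exp_diff exp_minus divide_inverse del: dilate_simps)
    ultimately show ?thesis by simp
  qed
  then have "fourier_coeff \<delta> \<theta> m (0 + \<Omega> *v axis j 1)
      = exp (- pi * \<i> * \<Omega> $ j $ j) * fourier_coeff \<delta> \<theta> (m + int (\<delta> j) *s axis j 1) 0"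
    by (simp add: fourier_coeff_def)
  then show ?thesis
    unfolding fourier_coeff_shift[OF ent theta_space_unit_periodic[OF th] pos, of m 0] by auto
qed

text \<open>The recursion is an equivalence, so it can be followed along each axis in both
  directions.\<close>

lemma fourier_coeff_Delta:
  assumes "\<theta> \<in> theta_space \<delta> \<Omega>" "\<And>j. \<delta> j > 0"
  shows "fourier_coeff \<delta> \<theta> (m + Delta \<delta> *v k) 0 = 0 \<longleftrightarrow> fourier_coeff \<delta> \<theta> m 0 = 0"
proof (induction k rule: int_vec_induct)
  case (2 k j)
  have "Delta \<delta> *v axis j 1 = int (\<delta> j) *s axis j 1"
    by (auto simp: vec_eq_iff axis_def)
  then show ?case
    using fourier_coeff_recursion[OF assms, of "m + Delta \<delta> *v k" j] 2
    by (simp add: matrix_vector_right_distrib add.assoc)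
next
  case (3 k j)
  have "Delta \<delta> *v axis j 1 = int (\<delta> j) *s axis j 1"
    by (auto simp: vec_eq_iff axis_def)
  then show ?case
    using fourier_coeff_recursion[OF assms, of "m + Delta \<delta> *v (k - axis j 1)" j] 3
    by (simp add: matrix_vector_mult_diff_distrib add.assoc)
qed simp

lemma representatives_cong:
  assumes "representatives \<delta> R"
  obtains \<epsilon> k where "\<epsilon> \<in> R" "m = \<epsilon> + Delta \<delta> *v k"
proof -
  have "Delta_cong \<delta> `` {m} \<in> UNIV // Delta_cong \<delta>"
    by (rule quotientI) simp
  with assms have "\<exists>!\<epsilon>. \<epsilon> \<in> R \<inter> Delta_cong \<delta> `` {m}"
    unfolding representatives_def by (rule bspec)
  then obtain \<epsilon> where "\<epsilon> \<in> R" "(m, \<epsilon>) \<in> Delta_cong \<delta>"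
    by blast
  then obtain k where "m - \<epsilon> = Delta \<delta> *v k" by (auto simp: Delta_cong_def)
  then show ?thesis using that[OF \<open>\<epsilon> \<in> R\<close>, of k] by (simp add: algebra_simps)
qed

lemma theta_eq_zero:
  assumes th: "\<theta> \<in> theta_space \<delta> \<Omega>" and pos: "\<And>j. \<delta> j > 0" and R: "representatives \<delta> R"
    and zero: "\<And>\<epsilon>. \<epsilon> \<in> R \<Longrightarrow> fourier_coeff \<delta> \<theta> \<epsilon> 0 = 0"
  shows "\<theta> w = 0"
proof -
  have ent: "entire \<theta>" using th by (simp add: theta_space_def)
  have "fourier_coeff \<delta> \<theta> m 0 = 0" for m
    using representatives_cong[OF R, of m] fourier_coeff_Delta[OF th pos] zero by metis
  \<comment> \<open>Vanishing is carried from base point 0 to every complex \<open>w\<close>, so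
    that uniqueness applies on every translate of the real torus and reaches all of complex
    space.\<close>
  then have "fourier_coeff \<delta> \<theta> m w = 0" for m
    using fourier_coeff_shift[OF ent theta_space_unit_periodic[OF th] pos, of m 0 w] by simp
  from this[of "- m" for m]
  have "integral (cbox 0 1) (\<lambda>x. \<theta> (w + dilate \<delta> x) * torus_char m x) = 0" for m
    unfolding fourier_coeff_def by simp
  then have "char_orthogonal (\<lambda>x. \<theta> (w + dilate \<delta> x))"
    using fourier_integrand_continuous[OF entire_continuous[OF ent], of UNIV w \<delta> 0]
    by (simp add: char_orthogonal_def)
  from fourier_uniqueness[OF theta_space_unit_periodic[OF th] this, of 0]
  show ?thesis by simp
qed

section \<open>Gaussian sums and exponential series\<close>


lemma summable_on_exp_neg_abs_int: "(\<lambda>k::int. exp (- \<bar>of_int k\<bar> :: real)) summable_on UNIV"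
proof -
  have nat: "(\<lambda>n::nat. exp (- real n)) summable_on UNIV"
  proof (rule norm_summable_imp_summable_on)
    have "summable (\<lambda>n. exp (- 1 :: real) ^ n)" by (intro summable_geometric) simp
    then show "summable (\<lambda>n. norm (exp (- real n)))"
      by (simp flip: exp_of_nat_mult)
  qed
  have 1: "(\<lambda>k::int. exp (- \<bar>of_int k\<bar> :: real)) summable_on range int"
    by (subst summable_on_reindex) (use nat in \<open>auto simp: o_def\<close>)
  have 2: "(\<lambda>k::int. exp (- \<bar>of_int k\<bar> :: real)) summable_on range (\<lambda>n. - int n)"
    by (subst summable_on_reindex) (use nat in \<open>auto simp: o_def inj_on_def\<close>)
  have "UNIV = range int \<union> (range (\<lambda>n. - int n) - range int)"
    by (auto intro: int_cases2)
  moreover have "(\<lambda>k::int. exp (- \<bar>of_int k\<bar> :: real)) summable_on \<dots>"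
    by (intro summable_on_Un_disjoint 1 summable_on_subset_banach[OF 2]) auto
  ultimately show ?thesis by simp
qed

text \<open>Any finite set of integer vectors lies in a box with equal sides \<open>S\<close>, over
  which the sum of products factors into a power of a one-dimensional sum. This bounds all finite
  partial sums at once.\<close>

lemma summable_on_prod_int_vec:
  fixes g :: "int \<Rightarrow> real"
  assumes nonneg: "\<And>k. g k \<ge> 0" and sum: "g summable_on UNIV"
  shows "(\<lambda>n::int ^ 'n. \<Prod>j\<in>UNIV. g (n $ j)) summable_on UNIV"
proof (rule nonneg_bdd_above_summable_on)
  show "(\<Prod>j\<in>UNIV. g (n $ j)) \<ge> 0" for n :: "int ^ 'n"
    by (intro prod_nonneg nonneg ballI)
  have "(\<Sum>n\<in>F. \<Prod>j\<in>UNIV. g (n $ j)) \<le> infsum g UNIV ^ CARD('n)" if F: "finite F" for F :: "(int ^ 'n) set"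
  proof -
    define S where "S = (\<Union>j. (\<lambda>n. n $ j) ` F)"
    have S: "finite S" using F by (simp add: S_def)
    have "(\<Sum>n\<in>F. \<Prod>j\<in>UNIV. g (n $ j)) = (\<Sum>p\<in>vec_nth ` F. \<Prod>j\<in>UNIV. g (p j))"
      by (subst sum.reindex) (auto simp: inj_on_def vec_nth_inject)
    also have "\<dots> \<le> (\<Sum>p\<in>PiE (UNIV :: 'n set) (\<lambda>_. S). \<Prod>j\<in>UNIV. g (p j))"
    proof (rule sum_mono2)
      show "finite (PiE (UNIV :: 'n set) (\<lambda>_. S))" by (intro finite_PiE S) simp
    qed (auto simp: S_def intro!: prod_nonneg nonneg)
    also have "\<dots> = (\<Prod>j\<in>(UNIV :: 'n set). \<Sum>k\<in>S. g k)"
      using S by (intro prod_sum_PiE[symmetric]) auto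
    also have "\<dots> \<le> infsum g UNIV ^ CARD('n)"
      using S finite_sum_le_infsum[OF sum S] nonneg by (simp add: power_mono sum_nonneg)
    finally show ?thesis .
  qed
  then show "bdd_above (sum (\<lambda>n::int ^ 'n. \<Prod>j\<in>UNIV. g (n $ j)) ` {F. F \<subseteq> UNIV \<and> finite F})"
    by (intro bdd_aboveI[of _ "infsum g UNIV ^ CARD('n)"]) auto
qed

text \<open>The quadratic term dominates every linear one, so the summand is at most a constant
  times the product of the exp(-|n_j|). The free \<open>B\<close> later absorbs the growth of the
  exponentials in z.\<close>

lemma summable_on_gaussian:
  fixes \<alpha> :: "real ^ 'n"
  assumes c: "c > 0"
  shows "(\<lambda>n. exp (B * norm (rvec n + \<alpha>) - c * (norm (rvec n + \<alpha>))\<^sup>2)) summable_on UNIV"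
proof -
  define L where "L = real CARD('n)"
  \<comment> \<open>(B + L)^2 / (4c) is the maximum of (B + L) t - c t^2 over real t.
    \<open>L\<close> counts the coordinates, each bounded by t + |\<alpha>|; L |\<alpha>| is the
    cost of the offset.\<close>
  define C where "C = (B + L)\<^sup>2 / (4 * c) + L * norm \<alpha>"
  have "exp (B * norm (rvec n + \<alpha>) - c * (norm (rvec n + \<alpha>))\<^sup>2)
      \<le> exp C * (\<Prod>j\<in>UNIV. exp (- \<bar>of_int (n $ j)\<bar>))" for n :: "int ^ 'n"
  proof -
    define t where "t = norm (rvec n + \<alpha>)"
    have "0 \<le> (2 * c * t - (B + L))\<^sup>2 / (4 * c)" using c by simp
    also have "\<dots> = c * t\<^sup>2 - (B + L) * t + (B + L)\<^sup>2 / (4 * c)"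
      using c by (simp add: power2_eq_square field_simps)
    finally have "B * t - c * t\<^sup>2 \<le> (B + L)\<^sup>2 / (4 * c) - L * t"
      by (simp add: algebra_simps)
    moreover have "(\<Sum>j\<in>UNIV. \<bar>of_int (n $ j)\<bar>) \<le> L * (t + norm \<alpha>)"
    proof -
      have "\<bar>of_int (n $ j)\<bar> \<le> t + norm \<alpha>" for j
      proof -
        have "\<bar>of_int (n $ j)\<bar> \<le> norm (rvec n)"
          using component_le_norm_cart[of "rvec n" j] by simp
        also have "\<dots> \<le> t + norm \<alpha>"
          using norm_triangle_ineq4[of "rvec n + \<alpha>" \<alpha>] by (simp add: t_def)
        finally show ?thesis .
      qed
      then have "(\<Sum>j\<in>UNIV. \<bar>of_int (n $ j)\<bar>) \<le> (\<Sum>j\<in>(UNIV :: 'n set). t + norm \<alpha>)"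
        by (intro sum_mono)
      then show ?thesis by (simp add: L_def)
    qed
    ultimately have "B * t - c * t\<^sup>2 \<le> C + (\<Sum>j\<in>UNIV. - \<bar>of_int (n $ j)\<bar>)"
      by (simp add: C_def sum_negf algebra_simps)
    then have "exp (B * t - c * t\<^sup>2) \<le> exp (C + (\<Sum>j\<in>UNIV. - \<bar>of_int (n $ j)\<bar>))"
      by simp
    then show ?thesis by (simp add: t_def exp_add exp_sum)
  qed
  then have le: "norm (exp (B * norm (rvec n + \<alpha>) - c * (norm (rvec n + \<alpha>))\<^sup>2))
      \<le> exp C * (\<Prod>j\<in>UNIV. exp (- \<bar>of_int (n $ j)\<bar>))" for n :: "int ^ 'n"
    by simp
  have "(\<lambda>n::int ^ 'n. exp C * (\<Prod>j\<in>UNIV. exp (- \<bar>of_int (n $ j)\<bar>))) summable_on UNIV"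
    by (intro summable_on_cmult_right summable_on_prod_int_vec summable_on_exp_neg_abs_int) simp
  from abs_summable_summable[OF Infinite_Sum.abs_summable_on_comparison_test'[OF this le]]
  show ?thesis .
qed

text \<open>The constant is the minimum of the quadratic form on the compact unit sphere;
  homogeneity of degree two extends the bound to all vectors.\<close>

lemma positive_definite_lower_bound:
  fixes A :: "real ^ 'n ^ 'n"
  assumes "positive_definite A"
  obtains c where "c > 0" "\<And>x. x \<bullet> (A *v x) \<ge> c * (norm x)\<^sup>2"
proof -
  have "axis undefined 1 \<in> sphere (0 :: real ^ 'n) 1" by simp
  then have ne: "sphere (0 :: real ^ 'n) 1 \<noteq> {}" by blast
  have "continuous_on (sphere 0 1) (\<lambda>x. x \<bullet> (A *v x))"
    by (intro continuous_intros)
  then obtain y where y: "y \<in> sphere 0 1" "\<And>x. x \<in> sphere 0 1 \<Longrightarrow> y \<bullet> (A *v y) \<le> x \<bullet> (A *v x)"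
    using continuous_attains_inf[OF compact_sphere ne] by blast
  have "y \<noteq> 0" using y(1) by auto
  then have "y \<bullet> (A *v y) > 0" using assms by (simp add: positive_definite_def)
  moreover have "x \<bullet> (A *v x) \<ge> (y \<bullet> (A *v y)) * (norm x)\<^sup>2" for x
  proof (cases "x = 0")
    case False
    define u where "u = x /\<^sub>R norm x"
    have x: "x = norm x *\<^sub>R u" using False by (simp add: u_def)
    have "u \<in> sphere 0 1" using False by (simp add: u_def)
    from y(2)[OF this] have "(y \<bullet> (A *v y)) * (norm x)\<^sup>2 \<le> (u \<bullet> (A *v u)) * (norm x)\<^sup>2"
      by (intro mult_right_mono) auto
    also have "\<dots> = (norm x *\<^sub>R u) \<bullet> (A *v (norm x *\<^sub>R u))"
      by (simp add: matrix_vector_mult_scaleR power2_eq_square)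
    finally show ?thesis using x by simp
  qed simp
  ultimately show ?thesis using that by blast
qed

lemma norm_exp_diff_le:
  fixes u :: complex
  shows "norm (exp u - 1 - u) \<le> (norm u)\<^sup>2 * exp (norm u)"
proof -
  have "(\<Sum>k\<le>1. u ^ k / fact k) = 1 + u"
    by simp
  then have "norm (exp u - 1 - u) \<le> exp \<bar>Re u\<bar> * (norm u)\<^sup>2"
    using Taylor_exp[of u 1] by (simp only: diff_diff_eq fact_1 div_by_1 Suc_1 One_nat_def[symmetric])
  also have "\<dots> \<le> exp (norm u) * (norm u)\<^sup>2"
    by (intro mult_right_mono) (auto simp: abs_Re_le_cmod)
  finally show ?thesis by (simp add: mult.commute)
qed

text \<open>The series is differentiated term by term. Summability for every \<open>B\<close> lets
  powers of \<open>r n\<close> be traded for factors exp(r n), which dominates both the derivative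
  series and the second-order remainder uniformly for increments of norm at most 1.\<close>

lemma entire_exp_series:
  fixes l :: "'i \<Rightarrow> complex ^ 'n \<Rightarrow> complex"
  assumes add: "\<And>n x y. l n (x + y) = l n x + l n y"
    and scale: "\<And>n s x. l n (s *s x) = s * l n x"
    and bound: "\<And>n x. norm (l n x) \<le> r n * norm x" and r: "\<And>n. r n \<ge> 0"
    and summable: "\<And>B. (\<lambda>n. norm (c n) * exp (B * r n)) summable_on UNIV"
  shows "entire (\<lambda>z. \<Sum>\<^sub>\<infinity>n. c n * exp (l n z))"
  unfolding entire_def
proof
  fix z :: "complex ^ 'n"
  define T where "T n = c n * exp (l n z)" for n
  define f where "f z = (\<Sum>\<^sub>\<infinity>n. c n * exp (l n z))" for z
  define f' where "f' h = (\<Sum>\<^sub>\<infinity>n. T n * l n h)" for h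
  have exp_le: "norm (exp (l n w)) \<le> exp (norm w * r n)" for n w
    using norm_exp[of "l n w"] bound[of n w] by (smt (verit) exp_le_cancel_iff mult.commute)
  have T_le: "norm (T n) \<le> norm (c n) * exp (norm z * r n)" for n
    unfolding T_def norm_mult by (intro mult_left_mono exp_le) simp
  have sum_f: "(\<lambda>n. c n * exp (l n w)) summable_on UNIV" for w
    by (rule abs_summable_summable, rule Infinite_Sum.abs_summable_on_comparison_test'[OF summable[of "norm w"]])
      (unfold norm_mult, intro mult_left_mono exp_le norm_ge_zero)
  have norm_f': "norm (T n * l n h) \<le> norm (c n) * exp ((norm z + 1) * r n) * norm h" for n h
  proof -
    have "r n \<le> exp (r n)" using exp_ge_add_one_self[of "r n"] by linarith
    then have "norm (T n) * norm (l n h) \<le> (norm (c n) * exp (norm z * r n)) * (exp (r n) * norm h)"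
      by (intro mult_mono T_le order_trans[OF bound] mult_right_mono) auto
    then show ?thesis by (simp add: norm_mult algebra_simps exp_add)
  qed
  have abs_f': "(\<lambda>n. norm (T n * l n h)) summable_on UNIV" for h
    by (rule Infinite_Sum.abs_summable_on_comparison_test'[OF summable_on_cmult_left[OF summable] norm_f'])
  note sum_f' = abs_summable_summable[OF abs_f']
  have f'_add: "f' (x + y) = f' x + f' y" for x y
    unfolding f'_def add distrib_left by (intro infsum_add sum_f')
  have f'_scale: "f' (s *s x) = s * f' x" for s x
    unfolding f'_def scale by (simp add: infsum_cmult_right' mult.left_commute)
  have bl: "bounded_linear f'"
  proof (rule bounded_linear_intro)
    show "f' (s *\<^sub>R x) = s *\<^sub>R f' x" for s x
    proof -
      have "s *\<^sub>R x = complex_of_real s *s x"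
        by (simp add: vec_eq_iff complex_eq_iff)
      then show ?thesis by (simp add: f'_scale scaleR_conv_of_real)
    qed
    show "norm (f' h) \<le> norm h * (\<Sum>\<^sub>\<infinity>n. norm (c n) * exp ((norm z + 1) * r n))" for h
    proof -
      have "norm (f' h) \<le> (\<Sum>\<^sub>\<infinity>n. norm (T n * l n h))"
        unfolding f'_def by (rule norm_infsum_bound[OF abs_f'])
      also have "\<dots> \<le> (\<Sum>\<^sub>\<infinity>n. norm (c n) * exp ((norm z + 1) * r n) * norm h)"
        by (intro infsum_mono abs_f' summable_on_cmult_left summable norm_f')
      also have "\<dots> = norm h * (\<Sum>\<^sub>\<infinity>n. norm (c n) * exp ((norm z + 1) * r n))"
        unfolding infsum_cmult_left' by (rule mult.commute)
      finally show ?thesis .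
    qed
  qed (rule f'_add)
  \<comment> \<open>One of the two extra factors exp(r n) comes from (r n)^2 <= 2 exp(r n), which
    also gives the factor 2; the other bounds the exponential in the Taylor remainder of
    exp.\<close>
  define M where "M n = 2 * (norm (c n) * exp ((norm z + 2) * r n))" for n
  have sum_M: "M summable_on UNIV"
    unfolding M_def by (intro summable_on_cmult_right summable)
  have rem_le: "norm (c n * exp (l n (z + h)) - c n * exp (l n z) - T n * l n h) \<le> M n * (norm h)\<^sup>2"
    if h: "norm h \<le> 1" for n h
  proof -
    have lh: "norm (l n h) \<le> r n"
      using bound[of n h] mult_left_mono[OF h r[of n]] by simp
    have "1 + r n + (r n)\<^sup>2 / 2 \<le> exp (r n)"
      using r by (rule exp_lower_Taylor_quadratic)
    then have r2: "(r n)\<^sup>2 \<le> 2 * exp (r n)" using r[of n] by simp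
    have "norm (exp (l n h) - 1 - l n h) \<le> (norm (l n h))\<^sup>2 * exp (norm (l n h))"
      by (rule norm_exp_diff_le)
    also have "\<dots> \<le> (r n * norm h)\<^sup>2 * exp (r n)"
      by (intro mult_mono power_mono bound) (use lh in auto)
    also have "\<dots> \<le> 2 * exp (r n) * (norm h)\<^sup>2 * exp (r n)"
      unfolding power_mult_distrib by (intro mult_right_mono r2) auto
    finally have "norm (T n) * norm (exp (l n h) - 1 - l n h)
        \<le> (norm (c n) * exp (norm z * r n)) * (2 * exp (r n) * (norm h)\<^sup>2 * exp (r n))"
      by (intro mult_mono T_le) auto
    also have "\<dots> = M n * (norm h)\<^sup>2"
    proof -
      have "exp ((norm z + 2) * r n) = exp (norm z * r n) * (exp (r n) * exp (r n))"
        by (simp add: distrib_right flip: exp_add)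
      then show ?thesis by (simp add: M_def)
    qed
    also have "norm (T n) * norm (exp (l n h) - 1 - l n h)
        = norm (c n * exp (l n (z + h)) - c n * exp (l n z) - T n * l n h)"
      by (simp add: T_def add exp_add right_diff_distrib mult.assoc flip: norm_mult)
    finally show ?thesis .
  qed
  have rem: "norm ((f w - f z) - f' (w - z)) / norm (w - z) \<le> infsum M UNIV * norm (w - z)"
    if "w \<noteq> z" "dist w z < 1" for w
  proof -
    define h where "h = w - z"
    have h: "norm h \<le> 1" "w = z + h" using that by (auto simp: h_def dist_norm)
    have diff: "((\<lambda>n. a n - b n) has_sum A - B) UNIV"
      if "(a has_sum A) UNIV" "(b has_sum B) UNIV" for a b :: "'i \<Rightarrow> complex" and A B
      using has_sum_add[OF that(1) has_sum_uminusI[OF that(2)]] by simp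
    have "((\<lambda>n. c n * exp (l n (z + h)) - c n * exp (l n z) - T n * l n h) has_sum (f w - f z) - f' h) UNIV"
      unfolding f_def f'_def h(2) by (intro diff has_sum_infsum sum_f sum_f')
    then have "norm ((f w - f z) - f' h) \<le> (\<Sum>\<^sub>\<infinity>n. M n * (norm h)\<^sup>2)"
      by (rule norm_infsum_le[OF _ has_sum_infsum])
        (intro summable_on_cmult_left sum_M rem_le h)+
    also have "\<dots> = infsum M UNIV * norm h * norm h"
      by (simp add: infsum_cmult_left' power2_eq_square)
    finally show ?thesis using that by (simp add: h_def divide_le_eq)
  qed
  \<comment> \<open>The remainder quotient is bounded by a multiple of the distance to z, hence
    tends to 0.\<close>
  have "((\<lambda>w. infsum M UNIV * norm (w - z)) \<longlongrightarrow> infsum M UNIV * norm (z - z)) (at z)"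
    by (intro tendsto_intros)
  then have "(f has_derivative f') (at z)"
    by (intro has_derivativeI_sandwich[of 1 f' UNIV z f "\<lambda>w. infsum M UNIV * norm (w - z)"] bl rem)
      auto
  moreover have "Vector_Spaces.linear (*s) (*) f'"
    by unfold_locales (auto simp: f'_add f'_scale algebra_simps)
  ultimately show "\<exists>f'. ((\<lambda>z. \<Sum>\<^sub>\<infinity>n. c n * exp (l n z)) has_derivative f') (at z) \<and> Vector_Spaces.linear (*s) (*) f'"
    unfolding f_def by blast
qed

text \<open>Characters have modulus one, so the M-test makes the series converge uniformly on the
  cube and allows termwise integration. Orthogonality keeps exactly the terms whose character has
  index m.\<close>

lemma fourier_coeff_exp_series:
  fixes l :: "'i \<Rightarrow> complex ^ 'n \<Rightarrow> complex"
  assumes summable: "(\<lambda>n. norm (c n)) summable_on UNIV"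
    and char: "\<And>n x. exp (l n (dilate \<delta> x)) = torus_char (p n) x"
  shows "((\<lambda>n. if p n = m then c n else 0) has_sum
           fourier_coeff \<delta> (\<lambda>z. \<Sum>\<^sub>\<infinity>n. c n * exp (l n z)) m 0) UNIV"
proof -
  define g where "g x = (\<Sum>\<^sub>\<infinity>n. c n * exp (l n (0 + dilate \<delta> x))) * torus_char (- m) x" for x
  have "uniform_limit (cbox 0 1) (\<lambda>X x. \<Sum>n\<in>X. c n * torus_char (p n - m) x)
      (\<lambda>x. \<Sum>\<^sub>\<infinity>n. c n * torus_char (p n - m) x) (finite_subsets_at_top UNIV)"
    by (rule Weierstrass_m_test_general[OF _ summable]) (simp add: norm_mult torus_char_def)
  also have "(\<lambda>x. \<Sum>\<^sub>\<infinity>n. c n * torus_char (p n - m) x) = g"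
    unfolding g_def add_0_left char infsum_cmult_left'[symmetric] mult.assoc torus_char_mult by simp
  finally obtain I J where IJ: "\<And>X. ((\<lambda>x. \<Sum>n\<in>X. c n * torus_char (p n - m) x) has_integral I X) (cbox 0 1)"
    "(g has_integral J) (cbox 0 1)" "(I \<longlongrightarrow> J) (finite_subsets_at_top UNIV)"
    by (rule uniform_limit_integral_cbox) (auto intro!: continuous_intros)
  have "I X = (\<Sum>n\<in>X. if p n = m then c n else 0)" if "finite X" for X
  proof -
    have "I X = integral (cbox 0 1) (\<lambda>x. \<Sum>n\<in>X. c n * torus_char (p n - m) x)"
      using IJ(1) by (rule integral_unique[symmetric])
    also have "\<dots> = (\<Sum>n\<in>X. integral (cbox 0 1) (\<lambda>x. c n * torus_char (p n - m) x))"
      by (intro integral_sum that integrable_continuous continuous_intros)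
    also have "\<dots> = (\<Sum>n\<in>X. if p n = m then c n else 0)"
      by (intro sum.cong) (auto simp: integral_torus_char)
    finally show ?thesis .
  qed
  then have "((\<lambda>X. \<Sum>n\<in>X. if p n = m then c n else 0) \<longlongrightarrow> J) (finite_subsets_at_top UNIV)"
    by (intro tendsto_cong[THEN iffD1, OF _ IJ(3)] eventually_finite_subsets_at_top_weakI)
  moreover have "fourier_coeff \<delta> (\<lambda>z. \<Sum>\<^sub>\<infinity>n. c n * exp (l n z)) m 0 = J"
    using integral_unique[OF IJ(2)] by (simp add: fourier_coeff_def g_def[abs_def])
  ultimately show ?thesis by (simp add: has_sum_def)
qed

section \<open>Theta functions with characteristics\<close>


lemma entire_add:
  assumes "entire f" "entire g"
  shows "entire (f + g)"
  unfolding entire_def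
proof
  fix z
  obtain f' g' where "(f has_derivative f') (at z)" "Vector_Spaces.linear (*s) (*) f'"
    "(g has_derivative g') (at z)" "Vector_Spaces.linear (*s) (*) g'"
    using assms unfolding entire_def by blast
  then have "(f + g has_derivative (\<lambda>h. f' h + g' h)) (at z) \<and> Vector_Spaces.linear (*s) (*) (\<lambda>h. f' h + g' h)"
    unfolding plus_fun_def by (auto simp: has_derivative_add Vector_Spaces.linear_iff distrib_left)
  then show "\<exists>f'. (f + g has_derivative f') (at z) \<and> Vector_Spaces.linear (*s) (*) f'" by blast
qed

lemma entire_scale:
  assumes "entire f"
  shows "entire (fun_scale s f)"
  unfolding entire_def
proof
  fix z
  obtain f' where "(f has_derivative f') (at z)" "Vector_Spaces.linear (*s) (*) f'"
    using assms unfolding entire_def by blast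
  then have "(fun_scale s f has_derivative (\<lambda>h. s * f' h)) (at z) \<and> Vector_Spaces.linear (*s) (*) (\<lambda>h. s * f' h)"
    unfolding fun_scale_def
    by (auto simp: has_derivative_mult_right Vector_Spaces.linear_iff distrib_left mult.left_commute)
  then show "\<exists>f'. (fun_scale s f has_derivative f') (at z) \<and> Vector_Spaces.linear (*s) (*) f'" by blast
qed

lemma subspace_theta_space: "cfun.subspace (theta_space \<delta> \<Omega>)"
proof (rule cfun.subspaceI)
  have "((\<lambda>x. 0) has_derivative (\<lambda>x. 0)) (at z) \<and> Vector_Spaces.linear (*s) (*) (\<lambda>x :: complex ^ 'b. 0 :: complex)" for z :: "complex ^ 'b"
    by (intro conjI has_derivative_const) (unfold_locales, auto)
  then have "entire (0 :: complex ^ 'b \<Rightarrow> complex)"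
    unfolding entire_def zero_fun_def by blast
  then show "0 \<in> theta_space \<delta> \<Omega>" by (simp add: theta_space_def)
qed (use entire_scale in \<open>auto simp: theta_space_def entire_add fun_scale_def distrib_left mult.left_commute\<close>)

section \<open>Representatives modulo \<Delta>\<close>

lemma representatives_unique:
  assumes "representatives \<delta> R" "\<epsilon> \<in> R" "\<epsilon>' \<in> R" "\<epsilon> = \<epsilon>' + Delta \<delta> *v k"
  shows "\<epsilon> = \<epsilon>'"
proof -
  have "Delta_cong \<delta> `` {\<epsilon>} \<in> UNIV // Delta_cong \<delta>"
    by (rule quotientI) simp
  with assms(1) have ex: "\<exists>!\<eta>. \<eta> \<in> R \<inter> Delta_cong \<delta> `` {\<epsilon>}"
    unfolding representatives_def by (rule bspec)
  have "\<epsilon> - \<epsilon> = Delta \<delta> *v 0" "\<epsilon> - \<epsilon>' = Delta \<delta> *v k"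
    using assms(4) by simp_all
  then have "\<epsilon> \<in> R \<inter> Delta_cong \<delta> `` {\<epsilon>}" "\<epsilon>' \<in> R \<inter> Delta_cong \<delta> `` {\<epsilon>}"
    using assms(2,3) unfolding Delta_cong_def by blast+
  with ex show ?thesis by blast
qed

text \<open>Coordinatewise reduction modulo \<delta>_j embeds \<open>R\<close> into a finite box,
  since equal remainders mean congruent vectors.\<close>

lemma finite_representatives:
  assumes pos: "\<And>j. \<delta> j > 0" and R: "representatives \<delta> R"
  shows "finite (R :: (int ^ 'n) set)"
proof (rule inj_on_finite)
  show "inj_on (\<lambda>m. vec_nth (\<chi> j. m $ j mod int (\<delta> j))) R"
  proof (rule inj_onI)
    fix m m' assume m: "m \<in> R" "m' \<in> R"
      and eq: "vec_nth (\<chi> j. m $ j mod int (\<delta> j)) = vec_nth (\<chi> j. m' $ j mod int (\<delta> j))"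
    have "\<exists>k. m $ j = m' $ j + int (\<delta> j) * k" for j
      using fun_cong[OF eq, of j] by (metis mod_eqE vec_lambda_beta)
    then obtain k where "\<And>j. m $ j = m' $ j + int (\<delta> j) * k j" by metis
    then have "m = m' + Delta \<delta> *v (\<chi> j. k j)" by (simp add: vec_eq_iff)
    then show "m = m'" using representatives_unique[OF R m] by blast
  qed
  show "(\<lambda>m. vec_nth (\<chi> j. m $ j mod int (\<delta> j))) ` R \<subseteq> PiE UNIV (\<lambda>j. {0..<int (\<delta> j)})"
    using pos by auto
  show "finite (PiE UNIV (\<lambda>j. {0..<int (\<delta> j)}))"
    by (intro finite_PiE) auto
qed

section \<open>The bilinear pairing and the functional equations of the theta series\<close>

lemma norm_cdot_le:
  fixes x y :: "complex ^ 'n"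
  shows "norm (cdot x y) \<le> real CARD('n) * norm x * norm y"
proof -
  have "norm (cdot x y) \<le> (\<Sum>j\<in>(UNIV :: 'n set). norm x * norm y)"
    unfolding cdot_def
  proof (rule sum_norm_le)
    show "norm (x $ j * y $ j) \<le> norm x * norm y" for j
      unfolding norm_mult by (rule mult_mono[OF Finite_Cartesian_Product.norm_nth_le Finite_Cartesian_Product.norm_nth_le]) auto
  qed
  then show ?thesis by simp
qed

lemma cdot_add_left: "cdot (x + y) z = cdot x z + cdot y z"
  by (simp add: cdot_def distrib_right sum.distrib)

lemma cdot_add_right: "cdot x (y + z) = cdot x y + cdot x z"
  by (simp add: cdot_def distrib_left sum.distrib)

lemma cdot_scale_right: "cdot x (s *s y) = s * cdot x y"
  by (simp add: cdot_def sum_distrib_left mult.left_commute)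

lemma cdot_axis: "cdot (axis j 1) z = z $ j"
  by (simp add: cdot_def axis_def if_distrib[of "\<lambda>x. x * _"] cong: if_cong)

lemma cdot_matrix_symmetric:
  assumes "transpose \<Omega> = \<Omega>"
  shows "cdot x (\<Omega> *v y) = cdot y (\<Omega> *v x)"
proof -
  have sym: "\<Omega> $ i $ j = \<Omega> $ j $ i" for i j
    using assms by (metis transpose_def vec_lambda_beta)
  have "cdot x (\<Omega> *v y) = (\<Sum>i\<in>UNIV. \<Sum>j\<in>UNIV. x $ i * (\<Omega> $ i $ j * y $ j))"
    by (simp add: cdot_def matrix_vector_mult_def sum_distrib_left)
  also have "\<dots> = (\<Sum>j\<in>UNIV. \<Sum>i\<in>UNIV. x $ i * (\<Omega> $ i $ j * y $ j))"
    by (rule sum.swap)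
  also have "\<dots> = (\<Sum>j\<in>UNIV. \<Sum>i\<in>UNIV. y $ j * (\<Omega> $ j $ i * x $ i))"
    by (intro sum.cong refl) (simp add: sym mult_ac)
  also have "\<dots> = cdot y (\<Omega> *v x)"
    by (simp add: cdot_def matrix_vector_mult_def sum_distrib_left)
  finally show ?thesis .
qed

lemma Delta_matrix_inv_mult:
  fixes \<delta> :: "'n::finite \<Rightarrow> nat" and v :: "complex ^ 'n"
  assumes "\<And>j. \<delta> j > 0"
  shows "matrix_inv (Delta \<delta>) *v v = (\<chi> j. v $ j / of_nat (\<delta> j))"
proof -
  define D :: "complex ^ 'n ^ 'n" where "D = (\<chi> i j. if i = j then 1 / of_nat (\<delta> i) else 0)"
  have "Delta \<delta> ** D = mat 1" "D ** Delta \<delta> = mat 1"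
    using assms
    by (auto simp: D_def Delta_def diag_mat_def matrix_matrix_mult_def mat_def vec_eq_iff
        if_distrib[of "\<lambda>x. x * _"] cong: if_cong)
  \<comment> \<open>\<open>matrix_inv\<close> is a choice of inverse; the explicit \<open>D\<close>
    shows that an inverse exists, so that the chosen matrix is one.\<close>
  then have "Delta \<delta> ** matrix_inv (Delta \<delta> :: complex ^ 'n ^ 'n) = mat 1"
    unfolding matrix_inv_def by (metis (mono_tags, lifting) someI_ex)
  then have "Delta \<delta> *v (matrix_inv (Delta \<delta>) *v v) = v"
    by (simp add: matrix_vector_mul_assoc)
  then have "of_nat (\<delta> j) * (matrix_inv (Delta \<delta>) *v v) $ j = v $ j" for j
    by (metis Delta_mult_nth)
  then show ?thesis using assms by (auto simp: vec_eq_iff field_simps)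
qed

text \<open>Completing the square turns the linear term in \<Omega> e_j into a translation of the
  summation index by e_j. Symmetry of \<Omega> merges the two cross terms.\<close>

lemma theta_char_quasi_periodic:
  assumes "transpose \<Omega> = \<Omega>"
  shows "theta_char a 0 \<Omega> (z + \<Omega> *v axis j 1)
       = exp (- pi * \<i> * \<Omega> $ j $ j - 2 * pi * \<i> * z $ j) * theta_char a 0 \<Omega> z"
proof -
  define q where "q x z = exp (pi * \<i> * cdot x (\<Omega> *v x) + 2 * pi * \<i> * cdot x z)" for x z
  have th: "theta_char a 0 \<Omega> z = (\<Sum>\<^sub>\<infinity>n. q (cvec n + a) z)" for z
    by (simp add: theta_char_def q_def)
  have cv: "cvec (n + axis j 1) + a = (cvec n + a) + axis j 1" for n
    by (auto simp: vec_eq_iff axis_def)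
  have jj: "cdot (axis j 1) (\<Omega> *v axis j 1) = \<Omega> $ j $ j"
    unfolding cdot_axis by (simp add: matrix_vector_mult_def axis_def if_distrib cong: if_cong)
  have "q x (z + \<Omega> *v axis j 1)
      = exp (- pi * \<i> * \<Omega> $ j $ j - 2 * pi * \<i> * z $ j) * q (x + axis j 1) z" for x
  proof -
    have 1: "cdot (x + axis j 1) (\<Omega> *v (x + axis j 1))
        = cdot x (\<Omega> *v x) + 2 * cdot x (\<Omega> *v axis j 1) + \<Omega> $ j $ j"
      using cdot_matrix_symmetric[OF assms, of "axis j 1" x]
      by (simp add: matrix_vector_right_distrib cdot_add_left cdot_add_right jj)
    have 2: "cdot x (z + \<Omega> *v axis j 1) = cdot x z + cdot x (\<Omega> *v axis j 1)"
      by (rule cdot_add_right)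
    have 3: "cdot (x + axis j 1) z = cdot x z + z $ j"
      by (simp only: cdot_add_left cdot_axis)
    show ?thesis
      unfolding q_def exp_add[symmetric] 1 2 3 by (rule arg_cong[of _ _ exp]) (simp add: field_simps)
  qed
  then have "theta_char a 0 \<Omega> (z + \<Omega> *v axis j 1)
      = (\<Sum>\<^sub>\<infinity>n. exp (- pi * \<i> * \<Omega> $ j $ j - 2 * pi * \<i> * z $ j) * q (cvec (n + axis j 1) + a) z)"
    by (simp only: th cv)
  also have "\<dots> = exp (- pi * \<i> * \<Omega> $ j $ j - 2 * pi * \<i> * z $ j) * (\<Sum>\<^sub>\<infinity>n. q (cvec (n + axis j 1) + a) z)"
    by (rule infsum_cmult_right')
  also have "(\<Sum>\<^sub>\<infinity>n. q (cvec (n + axis j 1) + a) z) = (\<Sum>\<^sub>\<infinity>n. q (cvec n + a) z)"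
    by (rule infsum_reindex_bij_betw[where g = "\<lambda>n. n + axis j 1" and f = "\<lambda>n. q (cvec n + a) z"])
      (rule bij_betwI[where g = "\<lambda>n. n - axis j 1"], auto)
  finally show ?thesis by (simp only: th)
qed

lemma theta_char_periodic:
  assumes pos: "\<And>j. \<delta> j > 0"
  shows "theta_char (\<chi> j. of_int (\<epsilon> $ j) / of_nat (\<delta> j)) 0 \<Omega> (z + Delta \<delta> *v cvec k)
       = theta_char (\<chi> j. of_int (\<epsilon> $ j) / of_nat (\<delta> j)) 0 \<Omega> z"
proof -
  define a :: "complex ^ 'a" where "a = (\<chi> j. of_int (\<epsilon> $ j) / of_nat (\<delta> j))"
  have "exp (2 * pi * \<i> * cdot (cvec n + a) (Delta \<delta> *v cvec k)) = 1" for n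
  proof -
    \<comment> \<open>The denominators \<delta>_j of the characteristic cancel against \<Delta>, so
      the pairing is an integer and its exponential is 1.\<close>
    have "cdot (cvec n + a) (Delta \<delta> *v cvec k)
        = of_int (\<Sum>j\<in>UNIV. (int (\<delta> j) * n $ j + \<epsilon> $ j) * k $ j)"
      unfolding cdot_def of_int_sum
      by (rule sum.cong) (use pos in \<open>auto simp: a_def field_simps\<close>)
    then obtain N :: int where "cdot (cvec n + a) (Delta \<delta> *v cvec k) = of_int N"
      by blast
    then show ?thesis
      using exp_integer_2pi[of "of_int N"] by (simp add: mult_ac)
  qed
  then show ?thesis
    unfolding a_def[symmetric] theta_char_def by (simp add: cdot_add_right distrib_left exp_add)
qed

section \<open>Fourier coefficients as linear functionals\<close>

lemma fourier_coeff_add: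
  assumes "continuous_on UNIV f" "continuous_on UNIV g"
  shows "fourier_coeff \<delta> (f + g) m w = fourier_coeff \<delta> f m w + fourier_coeff \<delta> g m w"
  unfolding fourier_coeff_def plus_fun_apply distrib_right
  by (intro integral_add integrable_continuous fourier_integrand_continuous assms)

lemma fourier_coeff_scale:
  "fourier_coeff \<delta> (fun_scale s f) m w = s * fourier_coeff \<delta> f m w"
  unfolding fourier_coeff_def fun_scale_def mult.assoc by simp

lemma fourier_coeff_zero: "fourier_coeff \<delta> (\<lambda>z. 0) m w = 0"
  by (simp add: fourier_coeff_def)

text \<open>Serves linear independence: the span of functions killed by a coefficient is killed as
  well. Continuity is part of the set because additivity of the integral relies on it.\<close>

lemma fourier_coeff_kernel_subspace:
  "cfun.subspace {f. continuous_on UNIV f \<and> fourier_coeff \<delta> f m w = 0}"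
proof (rule cfun.subspaceI)
  fix f g :: "complex ^ 'a \<Rightarrow> complex"
  assume "f \<in> {f. continuous_on UNIV f \<and> fourier_coeff \<delta> f m w = 0}"
    "g \<in> {f. continuous_on UNIV f \<and> fourier_coeff \<delta> f m w = 0}"
  then show "f + g \<in> {f. continuous_on UNIV f \<and> fourier_coeff \<delta> f m w = 0}"
    by (auto simp: fourier_coeff_add) (auto simp: plus_fun_def intro!: continuous_intros)
next
  fix s and f :: "complex ^ 'a \<Rightarrow> complex"
  assume "f \<in> {f. continuous_on UNIV f \<and> fourier_coeff \<delta> f m w = 0}"
  then show "fun_scale s f \<in> {f. continuous_on UNIV f \<and> fourier_coeff \<delta> f m w = 0}"
    by (auto simp: fourier_coeff_scale) (auto simp: fun_scale_def intro!: continuous_intros)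
qed (auto simp: fourier_coeff_zero zero_fun_def)

section \<open>Convergence, membership and coefficients of the theta series\<close>

lemma norm_theta_coeff:
  assumes "\<And>j. x $ j = complex_of_real (y $ j)"
  shows "norm (exp (pi * \<i> * cdot x (\<Omega> *v x))) = exp (- pi * (y \<bullet> (map_matrix Im \<Omega> *v y)))"
proof -
  \<comment> \<open>For a vector with real coordinates, the imaginary part of the form involves only
    the imaginary part of \<Omega>.\<close>
  have "Im (cdot x (\<Omega> *v x)) = y \<bullet> (map_matrix Im \<Omega> *v y)"
    by (simp add: cdot_def inner_vec_def matrix_vector_mult_def assms)
  then show ?thesis by (simp add: norm_exp_eq_Re)
qed

text \<open>A real characteristic keeps n + a real, so positive definiteness yields Gaussian decay.
  Arbitrary \<open>B\<close> serves entirety, and B = 0 gives the absolute convergence behind the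
  Fourier coefficients.\<close>

lemma theta_coeff_summable:
  fixes \<Omega> :: "complex ^ 'n ^ 'n"
  assumes pd: "positive_definite (map_matrix Im \<Omega>)" and a: "\<And>j. a $ j = complex_of_real (\<alpha> $ j)"
  shows "(\<lambda>n. norm (exp (pi * \<i> * cdot (cvec n + a) (\<Omega> *v (cvec n + a)))) * exp (B * norm (cvec n + a))) summable_on UNIV"
proof -
  obtain c where c: "c > 0" "\<And>x. x \<bullet> (map_matrix Im \<Omega> *v x) \<ge> c * (norm x)\<^sup>2"
    using positive_definite_lower_bound[OF pd] by blast
  have le: "norm (norm (exp (pi * \<i> * cdot (cvec n + a) (\<Omega> *v (cvec n + a)))) * exp (B * norm (cvec n + a)))
      \<le> exp (B * norm (rvec n + \<alpha>) - (pi * c) * (norm (rvec n + \<alpha>))\<^sup>2)" for n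
  proof -
    define y where "y = rvec n + \<alpha>"
    have y: "(cvec n + a) $ j = complex_of_real (y $ j)" for j by (simp add: y_def a)
    have "norm (cvec n + a) = norm y"
      unfolding norm_vec_def by (simp add: y del: vector_add_component)
    moreover have "pi * (y \<bullet> (map_matrix Im \<Omega> *v y)) \<ge> pi * c * (norm y)\<^sup>2"
      using mult_left_mono[OF c(2)[of y], of pi] by (simp add: mult.assoc)
    ultimately show ?thesis
      unfolding norm_theta_coeff[of "cvec n + a" y, OF y] y_def[symmetric]
      by (simp flip: exp_add)
  qed
  have "(\<lambda>n. exp (B * norm (rvec n + \<alpha>) - (pi * c) * (norm (rvec n + \<alpha>))\<^sup>2)) summable_on UNIV"
    using c(1) by (intro summable_on_gaussian) simp
  from abs_summable_summable[OF Infinite_Sum.abs_summable_on_comparison_test'[OF this le]]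
  show ?thesis .
qed

lemma theta_char_exp_series:
  "theta_char a 0 \<Omega> = (\<lambda>z. \<Sum>\<^sub>\<infinity>n. exp (pi * \<i> * cdot (cvec n + a) (\<Omega> *v (cvec n + a)))
      * exp (2 * pi * \<i> * cdot (cvec n + a) z))"
  by (simp add: theta_char_def[abs_def] exp_add)

lemma theta_char_entire:
  fixes \<Omega> :: "complex ^ 'n ^ 'n"
  assumes pd: "positive_definite (map_matrix Im \<Omega>)" and a: "\<And>j. a $ j = complex_of_real (\<alpha> $ j)"
  shows "entire (theta_char a 0 \<Omega>)"
  unfolding theta_char_exp_series
proof (rule entire_exp_series[where r = "\<lambda>n. 2 * pi * real CARD('n) * norm (cvec n + a)"])
  show "norm (2 * pi * \<i> * cdot (cvec n + a) x) \<le> 2 * pi * real CARD('n) * norm (cvec n + a) * norm x" for n x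
    using norm_cdot_le[of "cvec n + a" x] by (simp add: norm_mult mult.assoc)
  show "(\<lambda>n. norm (exp (pi * \<i> * cdot (cvec n + a) (\<Omega> *v (cvec n + a))))
      * exp (B * (2 * pi * real CARD('n) * norm (cvec n + a)))) summable_on UNIV" for B
    using theta_coeff_summable[OF pd a, of "B * (2 * pi * real CARD('n))"] by (simp only: mult.assoc)
qed (auto simp: cdot_add_right cdot_scale_right distrib_left)

lemma theta_char_in_theta_space:
  fixes \<delta> :: "'n::finite \<Rightarrow> nat"
  assumes "\<And>j. \<delta> j > 0" "transpose \<Omega> = \<Omega>" "positive_definite (map_matrix Im \<Omega>)"
  shows "theta_char (\<chi> j. of_int (\<epsilon> $ j) / of_nat (\<delta> j)) 0 \<Omega> \<in> theta_space \<delta> \<Omega>"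
proof -
  have "entire (theta_char (\<chi> j. of_int (\<epsilon> $ j) / of_nat (\<delta> j)) 0 \<Omega>)"
    by (rule theta_char_entire[OF assms(3), where \<alpha> = "\<chi> j. of_int (\<epsilon> $ j) / of_nat (\<delta> j)"]) simp
  then show ?thesis
    unfolding theta_space_def using theta_char_periodic[of \<delta>, OF assms(1)] theta_char_quasi_periodic[OF assms(2)]
    by blast
qed

text \<open>On the real torus the n-th term of the series is a constant times the character of index
  \<epsilon> + \<Delta> n. Distinct n give distinct indices, so the coefficient at \<epsilon> is the
  single constant \<open>c 0\<close>, an exponential and hence non-zero.\<close>

lemma theta_char_fourier_coeff:
  fixes \<delta> :: "'n::finite \<Rightarrow> nat" and \<Omega> :: "complex ^ 'n ^ 'n" and \<epsilon> :: "int ^ 'n"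
  assumes pos: "\<And>j. \<delta> j > 0" and pd: "positive_definite (map_matrix Im \<Omega>)"
  defines "\<theta> \<equiv> theta_char (\<chi> j. of_int (\<epsilon> $ j) / of_nat (\<delta> j)) 0 \<Omega>"
  shows "fourier_coeff \<delta> \<theta> \<epsilon> 0 \<noteq> 0"
    and "(\<And>k. m \<noteq> \<epsilon> + Delta \<delta> *v k) \<Longrightarrow> fourier_coeff \<delta> \<theta> m 0 = 0"
proof -
  define a :: "complex ^ 'n" where "a = (\<chi> j. of_int (\<epsilon> $ j) / of_nat (\<delta> j))"
  define c where "c n = exp (pi * \<i> * cdot (cvec n + a) (\<Omega> *v (cvec n + a)))" for n
  have \<theta>: "\<theta> = (\<lambda>z. \<Sum>\<^sub>\<infinity>n. c n * exp (2 * pi * \<i> * cdot (cvec n + a) z))"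
    unfolding \<theta>_def a_def[symmetric] theta_char_exp_series c_def ..
  have "(\<lambda>n. norm (c n)) summable_on UNIV"
    using theta_coeff_summable[OF pd, of a "\<chi> j. of_int (\<epsilon> $ j) / of_nat (\<delta> j)" 0]
    by (simp add: a_def c_def)
  moreover have "exp (2 * pi * \<i> * cdot (cvec n + a) (dilate \<delta> x)) = torus_char (\<epsilon> + Delta \<delta> *v n) x" for n x
  proof -
    have nz: "complex_of_nat (\<delta> j) \<noteq> 0" for j using pos[of j] by simp
    have "cdot (cvec n + a) (dilate \<delta> x) = of_real (rvec (\<epsilon> + Delta \<delta> *v n) \<bullet> x)"
      unfolding cdot_def inner_vec_def of_real_sum
      by (rule sum.cong) (use nz in \<open>auto simp: a_def field_simps\<close>)
    then show ?thesis by (simp add: torus_char_def cis_conv_exp mult_ac)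
  qed
  ultimately have coeff: "((\<lambda>n. if \<epsilon> + Delta \<delta> *v n = m then c n else 0) has_sum fourier_coeff \<delta> \<theta> m 0) UNIV" for m
    unfolding \<theta> by (rule fourier_coeff_exp_series)
  have nz: "\<delta> j \<noteq> 0" for j
    using pos[of j] by simp
  have "\<epsilon> + Delta \<delta> *v n = \<epsilon> \<longleftrightarrow> n = 0" for n
    by (simp add: vec_eq_iff nz)
  with coeff[of \<epsilon>] have "((\<lambda>n. if n = 0 then c n else 0) has_sum fourier_coeff \<delta> \<theta> \<epsilon> 0) UNIV"
    by simp
  moreover have "((\<lambda>n. if n = 0 then c n else 0) has_sum c 0) UNIV"
    by (rule has_sum_finite_neutralI[of "{0}"]) auto
  ultimately have "fourier_coeff \<delta> \<theta> \<epsilon> 0 = c 0"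
    by (rule has_sum_unique)
  then show "fourier_coeff \<delta> \<theta> \<epsilon> 0 \<noteq> 0" by (simp add: c_def)
  assume "\<And>k. m \<noteq> \<epsilon> + Delta \<delta> *v k"
  then have "((\<lambda>n :: int ^ 'n. 0) has_sum fourier_coeff \<delta> \<theta> m 0) UNIV"
    using coeff[of m] by (simp add: eq_commute)
  then show "fourier_coeff \<delta> \<theta> m 0 = 0"
    by (rule has_sum_unique) (rule has_sum_0_simp)
qed

theorem theorem1:
  fixes \<delta> :: "'n::{finite,linorder} \<Rightarrow> nat"
    and \<Omega> :: "((complex, 'n) vec, 'n) vec"
    and R :: "(int, 'n) vec set"
  assumes "\<And>j. \<delta> j > 0"
    and "\<And>i j. i < j \<Longrightarrow> {i<..<j} = {} \<Longrightarrow> \<delta> i dvd \<delta> j"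
    and "transpose \<Omega> = \<Omega>"
    and "positive_definite (map_matrix Im \<Omega>)"
    and "representatives \<delta> R"
  shows "basis_family
           (\<lambda>\<epsilon>. theta_char (matrix_inv (Delta \<delta>) *v cvec \<epsilon>) 0 \<Omega>) R (theta_space \<delta> \<Omega>)"
proof -
  define \<Theta> where "\<Theta> \<epsilon> = theta_char (matrix_inv (Delta \<delta>) *v cvec \<epsilon>) 0 \<Omega>" for \<epsilon>
  have \<Theta>: "\<Theta> \<epsilon> = theta_char (\<chi> j. of_int (\<epsilon> $ j) / of_nat (\<delta> j)) 0 \<Omega>" for \<epsilon>
    by (simp add: \<Theta>_def Delta_matrix_inv_mult[of \<delta>, OF assms(1)])
  have mem: "\<Theta> \<epsilon> \<in> theta_space \<delta> \<Omega>" for \<epsilon>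
    unfolding \<Theta> by (intro theta_char_in_theta_space assms)
  then have cont: "continuous_on UNIV (\<Theta> \<epsilon>)" for \<epsilon>
    unfolding theta_space_def by (auto intro: entire_continuous)
  have diag: "fourier_coeff \<delta> (\<Theta> \<epsilon>) \<epsilon> 0 \<noteq> 0" for \<epsilon>
    unfolding \<Theta> by (rule theta_char_fourier_coeff(1)[of \<delta>, OF assms(1,4)])
  have off: "fourier_coeff \<delta> (\<Theta> \<epsilon>) \<eta> 0 = 0" if "\<epsilon> \<in> R" "\<eta> \<in> R" "\<eta> \<noteq> \<epsilon>" for \<epsilon> \<eta>
    unfolding \<Theta>
    by (rule theta_char_fourier_coeff(2)[of \<delta>, OF assms(1,4)])
      (use representatives_unique[OF assms(5) that(2,1)] that(3) in blast)
  \<comment> \<open>If two distinct elements of \<open>R\<close> gave the same function, one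
    coefficient of it would be both zero and non-zero.\<close>
  have inj: "inj_on \<Theta> R"
    using diag off by (metis inj_onI)
  \<comment> \<open>The coefficient at \<epsilon> annihilates the span of all the other theta
    functions but not \<open>\<Theta> \<epsilon>\<close> itself.\<close>
  have indep: "cfun.independent (\<Theta> ` R)"
  proof
    assume "cfun.dependent (\<Theta> ` R)"
    then obtain \<epsilon> where \<epsilon>: "\<epsilon> \<in> R" "\<Theta> \<epsilon> \<in> cfun.span (\<Theta> ` R - {\<Theta> \<epsilon>})"
      unfolding cfun.dependent_def by blast
    have "cfun.span (\<Theta> ` R - {\<Theta> \<epsilon>}) \<subseteq> {f. continuous_on UNIV f \<and> fourier_coeff \<delta> f \<epsilon> 0 = 0}"
      by (rule cfun.span_minimal[OF _ fourier_coeff_kernel_subspace]) (use off \<epsilon>(1) cont in auto)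
    then show False using \<epsilon>(2) diag by blast
  qed
  have "\<theta> \<in> cfun.span (\<Theta> ` R)" if \<theta>: "\<theta> \<in> theta_space \<delta> \<Omega>" for \<theta>
  proof -
    \<comment> \<open>Dividing by the diagonal value makes \<open>S R\<close> agree with \<theta> in
      every coefficient indexed by \<open>R\<close>, since the off-diagonal values vanish.\<close>
    define \<kappa> where "\<kappa> \<epsilon> = fourier_coeff \<delta> \<theta> \<epsilon> 0 / fourier_coeff \<delta> (\<Theta> \<epsilon>) \<epsilon> 0" for \<epsilon>
    define S where "S F = (\<Sum>\<epsilon>\<in>F. fun_scale (\<kappa> \<epsilon>) (\<Theta> \<epsilon>))" for F
    have R: "finite R" using finite_representatives assms(1,5) by blast
    have S_span: "S F \<in> cfun.span (\<Theta> ` R)" if "F \<subseteq> R" for F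
      unfolding S_def by (intro cfun.span_sum cfun.span_scale cfun.span_base) (use that in auto)
    have span_sub: "cfun.span (\<Theta> ` R) \<subseteq> theta_space \<delta> \<Omega>"
      by (rule cfun.span_minimal[OF _ subspace_theta_space]) (use mem in auto)
    have cont': "continuous_on UNIV f" if "f \<in> theta_space \<delta> \<Omega>" for f
      using that unfolding theta_space_def by (auto intro: entire_continuous)
    have S_coeff: "fourier_coeff \<delta> (S F) \<eta> 0 = (if \<eta> \<in> F then fourier_coeff \<delta> \<theta> \<eta> 0 else 0)"
      if "finite F" "F \<subseteq> R" "\<eta> \<in> R" for F \<eta>
      using that
    proof (induction F)
      case empty
      then show ?case by (simp add: S_def fourier_coeff_zero)
    next
      case (insert \<epsilon> F)
      have "continuous_on UNIV (S F)" "continuous_on UNIV (fun_scale (\<kappa> \<epsilon>) (\<Theta> \<epsilon>))"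
        using insert.prems S_span[of F] span_sub mem[of \<epsilon>] subspace_theta_space
        by (auto intro!: cont' cfun.subspace_scale)
      then have "fourier_coeff \<delta> (S (insert \<epsilon> F)) \<eta> 0
          = \<kappa> \<epsilon> * fourier_coeff \<delta> (\<Theta> \<epsilon>) \<eta> 0 + fourier_coeff \<delta> (S F) \<eta> 0"
        using insert.hyps by (simp add: S_def fourier_coeff_add fourier_coeff_scale)
      then show ?case
        using insert off[of \<epsilon> \<eta>] diag[of \<epsilon>] by (auto simp: \<kappa>_def)
    qed
    have S_mem: "S R \<in> theta_space \<delta> \<Omega>" using S_span span_sub by blast
    \<comment> \<open>The difference of \<theta> and its candidate expansion is again a theta
      function and has vanishing coefficients on \<open>R\<close>, hence is zero. It is written with
      a scaling by -1 to match the closure rules of a subspace.\<close>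
    define D where "D = \<theta> + fun_scale (- 1) (S R)"
    have D: "D \<in> theta_space \<delta> \<Omega>"
      unfolding D_def by (intro cfun.subspace_add[OF subspace_theta_space] cfun.subspace_scale[OF subspace_theta_space] \<theta> S_mem)
    have "fourier_coeff \<delta> D \<eta> 0 = 0" if "\<eta> \<in> R" for \<eta>
    proof -
      have "fourier_coeff \<delta> D \<eta> 0 = fourier_coeff \<delta> \<theta> \<eta> 0 + - 1 * fourier_coeff \<delta> (S R) \<eta> 0"
        unfolding D_def fourier_coeff_scale[symmetric]
        by (intro fourier_coeff_add cont' \<theta> S_mem cfun.subspace_scale[OF subspace_theta_space])
      then show ?thesis using S_coeff[OF R order_refl that] that by simp
    qed
    then have "D w = 0" for w
      by (rule theta_eq_zero[OF D assms(1,5)])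
    then have "\<theta> = S R" by (simp add: D_def fun_eq_iff fun_scale_def)
    then show ?thesis using S_span by simp
  qed
  moreover have "cfun.span (\<Theta> ` R) \<subseteq> theta_space \<delta> \<Omega>"
    by (rule cfun.span_minimal[OF _ subspace_theta_space]) (use mem in auto)
  ultimately show ?thesis
    using inj indep unfolding basis_family_def \<Theta>_def[abs_def] by blast
qed

end
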